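(* Let $E$ be a Banach space and let $n\in\mathbb N$ with $n<\mathrm{cd}(E)$. Let $F$ be an infinite dimensional Banach space which is asymptotically uniformly smooth and which has a shrinking metric compact approximation of the identity $(L_\beta)\subset\mathcal K(F)$ such that $\sup_\beta\|L^\beta\|\le 1$, where $L^\beta=\mathrm{Id}_F-L_\beta$. Then $\mathcal P_w({}^nE,F)$ is an HB-subspace of $\mathcal P({}^nE,F)$.
   Context: All Banach spaces are over $\mathbb K=\mathbb R$ or $\mathbb C$ (the same field for $E$ and $F$); $B_E$ is the closed unit ball, and $\mathbb N=\{1,2,\dots\}$. $\mathcal P({}^nE,F)$ is the Banach space of continuous $n$-homogeneous polynomials $P:E\to F$ with norm $\|P\|=\sup_{x\in B_E}\|P(x)\|$. $\mathcal P_w({}^nE,F)$ is the subspace of those polynomials that are weakly continuous on bounded sets, i.e. that map bounded weakly convergent nets to norm-convergent nets. $\mathcal P({}^nE)$ and $\mathcal P_w({}^nE)$ denote these spaces for $F=\mathbb K$. Critical degree: $\mathrm{cd}(E):=\min\{k\in\mathbb N: \mathcal P_w({}^kE)\ne\mathcal P({}^kE)\}$ (with $\mathrm{cd}(E)=\infty$ if there is no such $k$). For a closed subspace $J$ of a Banach space $X$, $J^\perp=\{x^*\in X^*: x^*(y)=0\ \forall y\in J\}$. $J$ is an HB-subspace of $X$ if there is a linear projection $q$ on $X^*$ with $\ker q=J^\perp$ such that for each $f\in X^*$ with $f\ne qf$ one has $\|qf\|<\|f\|$ and $\|f-qf\|\le\|f\|$. $\mathcal K(F)$ is the space of compact operators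 on $F$. A metric compact approximation of the identity of $F$ is a net $(L_\beta)\subset\mathcal K(F)$ with $\sup_\beta\|L_\beta\|\le1$ and $L_\beta\to\mathrm{Id}_F$ pointwise; it is shrinking if in addition $L_\beta^*\to\mathrm{Id}_{F^*}$ pointwise. For an infinite dimensional Banach space $F$, $t>0$ and $\|x\|=1$, put $\overline\rho_F(t;x)=\inf_{\dim(F/H)<\infty}\ \sup_{h\in H,\|h\|\le t}\|x+h\|-1$ (infimum over finite-codimensional subspaces $H$ of $F$) and $\overline\rho_F(t)=\sup_{\|x\|=1}\overline\rho_F(t;x)$. $F$ is asymptotically uniformly smooth if $\lim_{t\to0}\overline\rho_F(t)/t=0$. *)

theory Defs
  imports "HOL-Analysis.Analysis" "HOL-Library.Function_Algebras" "HOL-Library.Extended_Nat"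
begin

text \<open>
  The scalar field is one of the real or the complex numbers, up to isometric isomorphism.
\<close>

class real_or_complex = real_normed_field +
  assumes ex_real_or_complex_iso:
    "\<exists>\<phi>::'a \<Rightarrow> complex.
       (\<forall>a b. \<phi> (a + b) = \<phi> a + \<phi> b) \<and> (\<forall>a b. \<phi> (a * b) = \<phi> a * \<phi> b) \<and>
       (\<forall>r a. \<phi> (r *\<^sub>R a) = r *\<^sub>R \<phi> a) \<and> (\<forall>a. norm (\<phi> a) = norm a) \<and>
       (range \<phi> = \<real> \<or> range \<phi> = UNIV)"

instance real :: real_or_complex
  by standard (rule exI[of _ complex_of_real], auto simp: Reals_def scaleR_conv_of_real)

instance complex :: real_or_complex
  by standard (rule exI[of _ "\<lambda>z. z"], auto)

text \<open>
  A Banach space over the scalar field is a type of class banach (which provides the norm, its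
  completeness and the underlying real vector space) with a compatible scalar multiplication.
\<close>

locale banach_over = vector_space scl
  for scl :: "'k::real_or_complex \<Rightarrow> 'a::banach \<Rightarrow> 'a" +
  assumes norm_scale: "norm (scl c x) = norm c * norm x"
    and scale_of_real: "scl (of_real r) x = r *\<^sub>R x"

text \<open>
  Normed spaces that are not types (such as spaces of polynomials) are given by a scalar
  multiplication, a carrier and a norm on it. Functionals on the carrier are
  represented by their extension by 0, so that equality of functions is equality of functionals.
\<close>

definition dual_space ::
    "('k::real_or_complex \<Rightarrow> 'v::ab_group_add \<Rightarrow> 'v) \<Rightarrow> 'v set \<Rightarrow> ('v \<Rightarrow> real) \<Rightarrow> ('v \<Rightarrow> 'k) set" where
  "dual_space scl X N = {f.
     (\<forall>x\<in>X. \<forall>y\<in>X. f (x + y) = f x + f y) \<and>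
     (\<forall>c. \<forall>x\<in>X. f (scl c x) = c * f x) \<and>
     (\<exists>C. \<forall>x\<in>X. norm (f x) \<le> C * N x) \<and>
     (\<forall>x. x \<notin> X \<longrightarrow> f x = 0)}"

definition dual_norm :: "'v set \<Rightarrow> ('v \<Rightarrow> real) \<Rightarrow> ('v \<Rightarrow> 'k::real_or_complex) \<Rightarrow> real" where
  "dual_norm X N f = (SUP x\<in>{x\<in>X. N x \<le> 1}. norm (f x))"

definition annihilator ::
    "('k::real_or_complex \<Rightarrow> 'v::ab_group_add \<Rightarrow> 'v) \<Rightarrow> 'v set \<Rightarrow> ('v \<Rightarrow> real) \<Rightarrow> 'v set \<Rightarrow> ('v \<Rightarrow> 'k) set" where
  "annihilator scl X N J = {f \<in> dual_space scl X N. \<forall>y\<in>J. f y = 0}"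

definition closed_subspace ::
    "('k::real_or_complex \<Rightarrow> 'v::ab_group_add \<Rightarrow> 'v) \<Rightarrow> 'v set \<Rightarrow> ('v \<Rightarrow> real) \<Rightarrow> 'v set \<Rightarrow> bool" where
  "closed_subspace scl X N J \<longleftrightarrow> J \<subseteq> X \<and> module.subspace scl J \<and>
     (\<forall>x\<in>X. (\<forall>e>0. \<exists>y\<in>J. N (x - y) < e) \<longrightarrow> x \<in> J)"

text \<open>
  Sums, differences and 0 of functionals are the pointwise ones of Function Algebras.
  The ambient pair (X, N) is meant to be a Banach space; its completeness is not part of the relation.
  The projection is only assumed to be linear; boundedness is not part of the definition.
\<close>

definition hb_subspace ::
    "('k::real_or_complex \<Rightarrow> 'v::ab_group_add \<Rightarrow> 'v) \<Rightarrow> 'v set \<Rightarrow> ('v \<Rightarrow> real) \<Rightarrow> 'v set \<Rightarrow> bool" where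
  "hb_subspace scl X N J \<longleftrightarrow> closed_subspace scl X N J \<and>
     (\<exists>q. (\<forall>f\<in>dual_space scl X N. q f \<in> dual_space scl X N) \<and>
          (\<forall>f\<in>dual_space scl X N. \<forall>g\<in>dual_space scl X N. q (f + g) = q f + q g) \<and>
          (\<forall>c. \<forall>f\<in>dual_space scl X N. q (\<lambda>x. c * f x) = (\<lambda>x. c * q f x)) \<and>
          (\<forall>f\<in>dual_space scl X N. q (q f) = q f) \<and>
          {f\<in>dual_space scl X N. q f = 0} = annihilator scl X N J \<and>
          (\<forall>f\<in>dual_space scl X N. f \<noteq> q f \<longrightarrow>
             dual_norm X N (q f) < dual_norm X N f \<and>
             dual_norm X N (f - q f) \<le> dual_norm X N f))"

text \<open>An n-linear map is a function of lists, of which only the values at lists of length n matter.\<close>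

definition multilinear ::
    "('k::real_or_complex \<Rightarrow> 'a::real_normed_vector \<Rightarrow> 'a) \<Rightarrow> ('k \<Rightarrow> 'b::real_normed_vector \<Rightarrow> 'b) \<Rightarrow>
      nat \<Rightarrow> ('a list \<Rightarrow> 'b) \<Rightarrow> bool" where
  "multilinear scaleE scaleF n A \<longleftrightarrow>
     (\<forall>xs i. length xs = n \<longrightarrow> i < n \<longrightarrow> Vector_Spaces.linear scaleE scaleF (\<lambda>x. A (xs[i := x])))"

definition poly_space ::
    "('k::real_or_complex \<Rightarrow> 'a::real_normed_vector \<Rightarrow> 'a) \<Rightarrow> ('k \<Rightarrow> 'b::real_normed_vector \<Rightarrow> 'b) \<Rightarrow>
      nat \<Rightarrow> ('a \<Rightarrow> 'b) set" where
  "poly_space scaleE scaleF n = {P. continuous_on UNIV P \<and>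
     (\<exists>A. multilinear scaleE scaleF n A \<and> (\<forall>x. P x = A (replicate n x)))}"

definition poly_norm :: "('a::real_normed_vector \<Rightarrow> 'b::real_normed_vector) \<Rightarrow> real" where
  "poly_norm P = (SUP x\<in>cball 0 1. norm (P x))"

definition fun_scale :: "('k \<Rightarrow> 'b \<Rightarrow> 'b) \<Rightarrow> 'k \<Rightarrow> ('a \<Rightarrow> 'b) \<Rightarrow> 'a \<Rightarrow> 'b" where
  "fun_scale scl c P = (\<lambda>x. scl c (P x))"

text \<open>
  Nets are expressed by filters: a net in the space corresponds to the filter generated by its tails.
\<close>

definition weakly_converges ::
    "('k::real_or_complex \<Rightarrow> 'a::real_normed_vector \<Rightarrow> 'a) \<Rightarrow> 'a filter \<Rightarrow> 'a \<Rightarrow> bool" where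
  "weakly_converges scl \<F> a \<longleftrightarrow> (\<forall>f\<in>dual_space scl UNIV norm. (f \<longlongrightarrow> f a) \<F>)"

definition weakly_cont_on_bounded ::
    "('k::real_or_complex \<Rightarrow> 'a::real_normed_vector \<Rightarrow> 'a) \<Rightarrow> ('a \<Rightarrow> 'b::real_normed_vector) \<Rightarrow> bool" where
  "weakly_cont_on_bounded scl P \<longleftrightarrow>
     (\<forall>\<F> B a. bounded B \<longrightarrow> eventually (\<lambda>x. x \<in> B) \<F> \<longrightarrow> weakly_converges scl \<F> a \<longrightarrow>
        (P \<longlongrightarrow> P a) \<F>)"

definition weak_poly_space ::
    "('k::real_or_complex \<Rightarrow> 'a::real_normed_vector \<Rightarrow> 'a) \<Rightarrow> ('k \<Rightarrow> 'b::real_normed_vector \<Rightarrow> 'b) \<Rightarrow>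
      nat \<Rightarrow> ('a \<Rightarrow> 'b) set" where
  "weak_poly_space scaleE scaleF n =
     {P \<in> poly_space scaleE scaleF n. weakly_cont_on_bounded scaleE P}"

text \<open>The infimum of the empty set of extended naturals is infinity.\<close>

definition critical_degree ::
    "('k::real_or_complex \<Rightarrow> 'a::real_normed_vector \<Rightarrow> 'a) \<Rightarrow> enat" where
  "critical_degree scl =
     (INF k\<in>{k. 1 \<le> k \<and> weak_poly_space scl ((*) :: 'k \<Rightarrow> 'k \<Rightarrow> 'k) k \<noteq> poly_space scl (*) k}. enat k)"

definition compact_operator ::
    "('k::real_or_complex \<Rightarrow> 'a::real_normed_vector \<Rightarrow> 'a) \<Rightarrow> ('a \<Rightarrow> 'a) \<Rightarrow> bool" where
  "compact_operator scl T \<longleftrightarrow>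
     Vector_Spaces.linear scl scl T \<and> compact (closure (T ` cball 0 1))"

text \<open>
  A net of operators is a family together with a proper filter on its index type
  (for a directed index set, the filter generated by the tails).
\<close>

definition metric_compact_approx ::
    "('k::real_or_complex \<Rightarrow> 'a::real_normed_vector \<Rightarrow> 'a) \<Rightarrow> 'i filter \<Rightarrow> ('i \<Rightarrow> 'a \<Rightarrow> 'a) \<Rightarrow> bool" where
  "metric_compact_approx scl \<F> L \<longleftrightarrow> \<F> \<noteq> bot \<and>
     (\<forall>\<beta>. compact_operator scl (L \<beta>)) \<and> (\<forall>\<beta>. onorm (L \<beta>) \<le> 1) \<and>
     (\<forall>x. ((\<lambda>\<beta>. L \<beta> x) \<longlongrightarrow> x) \<F>)"

definition shrinking_metric_compact_approx ::
    "('k::real_or_complex \<Rightarrow> 'a::real_normed_vector \<Rightarrow> 'a) \<Rightarrow> 'i filter \<Rightarrow> ('i \<Rightarrow> 'a \<Rightarrow> 'a) \<Rightarrow> bool" where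
  "shrinking_metric_compact_approx scl \<F> L \<longleftrightarrow> metric_compact_approx scl \<F> L \<and>
     (\<forall>f\<in>dual_space scl UNIV norm.
        ((\<lambda>\<beta>. dual_norm UNIV norm ((f \<circ> L \<beta>) - f)) \<longlongrightarrow> 0) \<F>)"

definition infinite_dimensional :: "('k::field \<Rightarrow> 'a::ab_group_add \<Rightarrow> 'a) \<Rightarrow> bool" where
  "infinite_dimensional scl \<longleftrightarrow> \<not> (\<exists>B. finite B \<and> module.span scl B = UNIV)"

text \<open>The quotient by H is finite dimensional iff it is spanned by the classes of a finite set B.\<close>

definition finite_codim_subspace :: "('k::field \<Rightarrow> 'a::ab_group_add \<Rightarrow> 'a) \<Rightarrow> 'a set \<Rightarrow> bool" where
  "finite_codim_subspace scl H \<longleftrightarrow> module.subspace scl H \<and>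
     (\<exists>B. finite B \<and> module.span scl (H \<union> B) = UNIV)"

definition smooth_modulus_at ::
    "('k::real_or_complex \<Rightarrow> 'a::real_normed_vector \<Rightarrow> 'a) \<Rightarrow> real \<Rightarrow> 'a \<Rightarrow> real" where
  "smooth_modulus_at scl t x =
     (INF H\<in>{H. finite_codim_subspace scl H}. SUP h\<in>{h\<in>H. norm h \<le> t}. norm (x + h)) - 1"

definition smooth_modulus ::
    "('k::real_or_complex \<Rightarrow> 'a::real_normed_vector \<Rightarrow> 'a) \<Rightarrow> real \<Rightarrow> real" where
  "smooth_modulus scl t = (SUP x\<in>sphere 0 1. smooth_modulus_at scl t x)"

definition asymptotically_uniformly_smooth ::
    "('k::real_or_complex \<Rightarrow> 'a::real_normed_vector \<Rightarrow> 'a) \<Rightarrow> bool" where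
  "asymptotically_uniformly_smooth scl \<longleftrightarrow>
     ((\<lambda>t. smooth_modulus scl t / t) \<longlongrightarrow> 0) (at_right 0)"

end

theory Submission
  imports Defs
begin

text \<open>
  Write \<open>X\<close> for the space of polynomials and \<open>J\<close> for its weakly continuous part. Composition with
  the compact operators \<open>L \<beta>\<close> of the approximation of the identity defines contractions on \<open>X\<close>, and
  the projection on the dual of \<open>X\<close> is the limit, along an ultrafilter, of their adjoints:
  \<open>q f P\<close> is the limit of the values of \<open>f\<close> at \<open>L \<beta> \<circ> P\<close>.

  That the kernel of \<open>q\<close> is the annihilator of \<open>J\<close> needs two facts about polynomials. The
  compositions \<open>L \<beta> \<circ> P\<close> belong to \<open>J\<close> for every \<open>P\<close> in \<open>X\<close> (lemma \<open>compact_operator_comp_weak\<close>): below the critical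
  degree they are weak-to-weak continuous on bounded sets, and a compact operator takes values in
  sets on which the weak and the norm topology agree. For \<open>P\<close> in \<open>J\<close> the compositions converge to \<open>P\<close>
  in norm (lemma \<open>weak_approximation\<close>), because \<open>P\<close> maps the unit ball to a totally bounded set
  (theorem \<open>weakly_uniformly_continuous_on_bounded\<close>).

  The bound for \<open>f - q f\<close> comes from the complements of \<open>L \<beta>\<close> being contractions. The strict
  inequality for \<open>q f\<close> comes from smoothness: for \<open>y\<close> in a compact subset of the unit ball of the
  range space and large \<open>\<beta>\<close>, the norm of \<open>y + t *\<^sub>R (z - L \<beta> z)\<close> is at most \<open>1 + \<kappa> * t\<close> uniformly in
  the vectors \<open>z\<close> of the unit ball, with \<open>\<kappa>\<close> as small as desired when \<open>t\<close> is small (lemma \<open>smooth_tail_compact\<close>).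
  If \<open>f\<close> differs from \<open>q f\<close>, such a perturbation increases the value of \<open>f\<close> at a polynomial
  \<open>L \<alpha> \<circ> P\<close> by a fixed multiple of \<open>t\<close> at an almost negligible cost in norm, so the
  values of \<open>q f\<close> on the unit ball stay away from the norm of \<open>f\<close> (lemma
  \<open>dual_norm_projection_strict\<close>).
\<close>

section \<open>Scalars and limits along ultrafilters\<close>

text \<open>
The isometry of the definition carries balls to closed bounded subsets of the plane.
\<close>

lemma compact_cball_scalars: "compact (cball 0 r :: 'k::real_or_complex set)"
proof -
  obtain \<phi> :: "'k \<Rightarrow> complex" where add: "\<And>a b. \<phi> (a + b) = \<phi> a + \<phi> b"
    and iso: "\<And>a. norm (\<phi> a) = norm a" and range: "range \<phi> = \<real> \<or> range \<phi> = UNIV"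
    using ex_real_or_complex_iso by blast
  have diff: "\<phi> (a - b) = \<phi> a - \<phi> b" for a b
    using add[of "a - b" b] by simp
  have dist: "dist (\<phi> a) (\<phi> b) = dist a b" for a b
    by (simp add: dist_norm diff[symmetric] iso)
  have inj: "inj \<phi>"
    by (rule injI) (metis dist dist_eq_0_iff)
  have "closed (range \<phi>)"
    using range closed_complex_Reals by auto
  then have comp: "compact (range \<phi> \<inter> cball 0 r)"
    by (rule closed_Int_compact) simp
  have "dist (inv \<phi> u) (inv \<phi> v) = dist u v" if "u \<in> range \<phi>" "v \<in> range \<phi>" for u v
    using that dist inj by (auto simp: inv_f_f)
  then have "continuous_on (range \<phi> \<inter> cball 0 r) (inv \<phi>)"
    by (auto simp: continuous_on_iff)
  moreover have "inv \<phi> ` (range \<phi> \<inter> cball 0 r) = cball 0 r"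
  proof (intro subset_antisym subsetI)
    fix k :: 'k assume "k \<in> cball 0 r"
    then have "\<phi> k \<in> range \<phi> \<inter> cball 0 r"
      by (simp add: iso)
    then show "k \<in> inv \<phi> ` (range \<phi> \<inter> cball 0 r)"
      using inj by (metis image_eqI inv_f_f)
  qed (use inj iso in \<open>auto simp: inv_f_f\<close>)
  ultimately show ?thesis
    using compact_continuous_image[OF _ comp, of "inv \<phi>"] by simp
qed

text \<open>
Rotating one of two scalars makes their moduli add up. This turns estimates of the modulus of a
functional on a sum into estimates of the sum of two moduli.
\<close>

lemma exists_phase:
  fixes a b :: "'k::real_normed_field"
  shows "\<exists>c. norm c = 1 \<and> norm (a + c * b) = norm a + norm b"
proof (cases "a = 0 \<or> b = 0")
  case True
  then show ?thesis by (intro exI[of _ 1]) auto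
next
  case False
  define c where "c = of_real (norm b / norm a) * a / b"
  have "norm c = 1"
    using False by (simp add: c_def norm_mult norm_divide)
  moreover have "a + c * b = of_real (1 + norm b / norm a) * a"
    using False by (simp add: c_def algebra_simps)
  then have "norm (a + c * b) = (1 + norm b / norm a) * norm a"
    by (simp only: norm_mult norm_of_real) (simp add: abs_of_nonneg)
  then have "norm (a + c * b) = norm a + norm b"
    using False by (simp add: field_simps)
  ultimately show ?thesis by blast
qed

text \<open>
Bounded scalar families need not converge along the filter of an approximation of the identity.
Passing to a finer ultrafilter gives a limit for all of them at once, and this limit is linear.
\<close>

definition ultrafilter :: "'a filter \<Rightarrow> bool" where
  "ultrafilter G \<longleftrightarrow> G \<noteq> bot \<and> (\<forall>P. eventually P G \<or> eventually (\<lambda>x. \<not> P x) G)"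

lemma ex_ultrafilter_le:
  assumes "F \<noteq> (bot :: 'a filter)"
  shows "\<exists>G\<le>F. ultrafilter G"
proof -
  let ?A = "{G. G \<noteq> bot \<and> G \<le> F}"
  have "\<exists>m\<in>?A. \<forall>a\<in>?A. a \<le> m \<longrightarrow> a = m"
  proof (rule predicate_Zorn)
    show "partial_order_on ?A (relation_of (\<lambda>a b. b \<le> a) ?A)"
      by (rule partial_order_on_relation_ofI) auto
  next
    fix C assume "C \<in> Chains (relation_of (\<lambda>a b. b \<le> a) ?A)"
    then have C: "\<And>G. G \<in> C \<Longrightarrow> G \<noteq> bot \<and> G \<le> F"
      and chain: "\<And>G H. G \<in> C \<Longrightarrow> H \<in> C \<Longrightarrow> G \<le> H \<or> H \<le> G"
      by (auto simp: Chains_def relation_of_def)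
    show "\<exists>u\<in>?A. \<forall>a\<in>C. u \<le> a"
    proof (cases "C = {}")
      case True
      then show ?thesis using assms by auto
    next
      case False
      have "\<exists>K\<in>C. K \<le> inf G H" if "G \<in> C" "H \<in> C" for G H
        using chain[OF that] that by (auto intro: bexI[of _ G] bexI[of _ H])
      with False have "eventually P (Inf C) \<longleftrightarrow> (\<exists>G\<in>C. eventually P G)" for P
        by (rule eventually_Inf_base)
      then have "Inf C \<noteq> bot"
        using C by (auto simp: trivial_limit_def)
      moreover have "Inf C \<le> F"
        using False C by (meson Inf_lower2 all_not_in_conv)
      ultimately show ?thesis
        by (auto intro: Inf_lower)
    qed
  qed
  then obtain G where G: "G \<noteq> bot" "G \<le> F"
    and min: "\<And>H. H \<noteq> bot \<Longrightarrow> H \<le> F \<Longrightarrow> H \<le> G \<Longrightarrow> H = G"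
    by auto
  have "eventually P G \<or> eventually (\<lambda>x. \<not> P x) G" for P
  proof (rule disjCI)
    assume "\<not> eventually (\<lambda>x. \<not> P x) G"
    then have "inf G (principal {x. P x}) \<noteq> bot"
      by (auto simp: trivial_limit_def eventually_inf_principal)
    then have "inf G (principal {x. P x}) = G"
      by (rule min) (use G(2) in \<open>auto intro: le_infI1\<close>)
    then have "G \<le> principal {x. P x}"
      by (metis inf.cobounded2)
    then show "eventually P G"
      by (simp add: le_principal)
  qed
  with G show ?thesis
    unfolding ultrafilter_def by blast
qed

lemma ultrafilter_tendsto_compact:
  assumes U: "ultrafilter U" and S: "compact S" and h: "eventually (\<lambda>x. h x \<in> S) U"
  shows "\<exists>l\<in>S. (h \<longlongrightarrow> l) U"
proof -
  have "filtermap h U \<noteq> bot" "eventually (\<lambda>y. y \<in> S) (filtermap h U)"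
    using U h by (auto simp: ultrafilter_def filtermap_bot_iff eventually_filtermap)
  then obtain l where l: "l \<in> S" "inf (nhds l) (filtermap h U) \<noteq> bot"
    using S unfolding compact_filter by blast
  have "(h \<longlongrightarrow> l) U"
  proof (rule topological_tendstoI, rule ccontr)
    fix V assume V: "open V" "l \<in> V" and "\<not> (\<forall>\<^sub>F x in U. h x \<in> V)"
    then have "\<forall>\<^sub>F x in U. h x \<notin> V"
      using U by (auto simp: ultrafilter_def)
    then have "\<forall>\<^sub>F y in filtermap h U. y \<notin> V" by (simp add: eventually_filtermap)
    moreover have "\<forall>\<^sub>F y in nhds l. y \<in> V"
      using V by (rule eventually_nhds_in_open)
    ultimately have "inf (nhds l) (filtermap h U) = bot"
      by (auto simp: trivial_limit_def eventually_inf)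
    with l show False by simp
  qed
  with l show ?thesis by blast
qed

text \<open>
On a compact set, continuous functions that separate points determine convergence: every cluster
point of the family must be the candidate limit.
\<close>

lemma tendsto_of_separating_functions:
  fixes h :: "'a \<Rightarrow> 'b::topological_space" and D :: "('b \<Rightarrow> 'c::t2_space) set"
  assumes S: "compact S" and h: "eventually (\<lambda>x. h x \<in> S) G"
    and cont: "\<And>f. f \<in> D \<Longrightarrow> continuous_on UNIV f"
    and lim: "\<And>f. f \<in> D \<Longrightarrow> ((\<lambda>x. f (h x)) \<longlongrightarrow> f l) G"
    and sep: "\<And>y. y \<noteq> l \<Longrightarrow> \<exists>f\<in>D. f y \<noteq> f l"
  shows "(h \<longlongrightarrow> l) G"
proof (rule topological_tendstoI, rule ccontr)
  fix V assume V: "open V" "l \<in> V" and nV: "\<not> (\<forall>\<^sub>F x in G. h x \<in> V)"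
  define G' where "G' = inf G (principal {x. h x \<notin> V})"
  have "G' \<noteq> bot"
    using nV by (auto simp: G'_def trivial_limit_def eventually_inf_principal)
  moreover have "eventually (\<lambda>y. y \<in> S) (filtermap h G')"
    using h by (auto simp: G'_def eventually_filtermap eventually_inf_principal elim: eventually_mono)
  ultimately obtain y where y: "inf (nhds y) (filtermap h G') \<noteq> bot"
    using S unfolding compact_filter by (metis filtermap_bot_iff)
  have "f y = f l" if f: "f \<in> D" for f
  proof (rule tendsto_unique[OF y])
    have "(f \<longlongrightarrow> f y) (nhds y)"
      using cont[OF f] by (metis UNIV_I continuous_on_def open_UNIV at_within_open isCont_def tendsto_at_iff_tendsto_nhds)
    then show "(f \<longlongrightarrow> f y) (inf (nhds y) (filtermap h G'))"
      by (rule tendsto_mono[rotated]) simp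
    have "((\<lambda>x. f (h x)) \<longlongrightarrow> f l) G'"
      using lim[OF f] by (rule tendsto_mono[rotated]) (simp add: G'_def)
    then have "(f \<longlongrightarrow> f l) (filtermap h G')"
      by (simp add: filterlim_filtermap)
    then show "(f \<longlongrightarrow> f l) (inf (nhds y) (filtermap h G'))"
      by (rule tendsto_mono[rotated]) simp
  qed
  with sep have "y = l" by blast
  with V have "\<forall>\<^sub>F z in nhds y. z \<in> V"
    by (simp add: eventually_nhds_in_open)
  moreover have "\<forall>\<^sub>F z in filtermap h G'. z \<notin> V"
    by (simp add: eventually_filtermap G'_def eventually_inf_principal)
  ultimately have "inf (nhds y) (filtermap h G') = bot"
    by (auto simp: trivial_limit_def eventually_inf)
  with y show False by simp
qed

section \<open>Weak continuity and finite differences\<close>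

text \<open>
Polynomials enter the proof of uniform weak continuity only through the fact that taking
differences lowers their degree, so the degree is measured by iterated differences. This avoids
polarization and derivatives of the polynomial.
\<close>

primrec difference_degree :: "nat \<Rightarrow> ('a::ab_group_add \<Rightarrow> 'b::ab_group_add) \<Rightarrow> bool" where
  "difference_degree 0 P \<longleftrightarrow> (\<forall>a x. P (x + a) = P x)"
| "difference_degree (Suc n) P \<longleftrightarrow> (\<forall>a. difference_degree n (\<lambda>x. P (x + a) - P x))"

lemma difference_degree_zero: "difference_degree n (\<lambda>x. 0)"
  by (induction n) auto

lemma difference_degree_add:
  "difference_degree n P \<Longrightarrow> difference_degree n Q \<Longrightarrow> difference_degree n (\<lambda>x. P x + Q x)"
proof (induction n arbitrary: P Q)
  case (Suc n)
  show ?case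
  proof (simp, intro allI)
    fix a
    have "difference_degree n (\<lambda>x. (P (x + a) - P x) + (Q (x + a) - Q x))"
      using Suc by auto
    then show "difference_degree n (\<lambda>x. P (x + a) + Q (x + a) - (P x + Q x))"
      by (simp add: algebra_simps)
  qed
qed simp

text \<open>
An entry of the argument list of a multilinear map is either a translate of the variable or a
constant; the flag tells which.
\<close>

definition slot :: "'a::ab_group_add \<Rightarrow> bool \<times> 'a \<Rightarrow> 'a" where
  "slot x s = (if fst s then x + snd s else snd s)"

lemma slot_const: "\<not> fst s \<Longrightarrow> slot x s = snd s"
  by (simp add: slot_def)

text \<open>
A multilinear map with \<open>m\<close> moving slots has degree at most \<open>m\<close>: moving the slots from \<open>x\<close> to
\<open>x + a\<close> one after the other writes the difference as a telescoping sum, and in each of its terms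
one moving slot has become the constant \<open>a\<close>. The statement has to allow constants and different
translates in the slots, since both arise in this step.
\<close>

lemma difference_degree_slots:
  fixes A :: "'a::ab_group_add list \<Rightarrow> 'b::ab_group_add"
  assumes add: "\<And>ys u v zs. Suc (length ys + length zs) = n \<Longrightarrow>
      A (ys @ (u + v) # zs) = A (ys @ u # zs) + A (ys @ v # zs)"
    and "length s = n"
  shows "difference_degree (length (filter fst s)) (\<lambda>x. A (map (slot x) s))"
  using \<open>length s = n\<close>
proof (induction "length (filter fst s)" arbitrary: s)
  case 0
  then have "\<forall>p\<in>set s. \<not> fst p"
    by (simp add: filter_empty_conv)
  then have "map (slot (x + a)) s = map (slot x) s" for a x
    by (auto simp: slot_def)
  then show ?case
    unfolding 0(1)[symmetric] difference_degree.simps by metis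
next
  case (Suc m)
  have telescope: "difference_degree m
      (\<lambda>x. A (map (slot x) pre @ map (slot (x + a)) suf) - A (map (slot x) (pre @ suf)))"
    if "length pre + length suf = n" "length (filter fst (pre @ suf)) = Suc m" for a pre suf
    using that
  proof (induction suf arbitrary: pre)
    case Nil
    then show ?case by (simp add: difference_degree_zero)
  next
    case (Cons p suf)
    have IH: "difference_degree m
      (\<lambda>x. A (map (slot x) (pre @ [p]) @ map (slot (x + a)) suf) - A (map (slot x) ((pre @ [p]) @ suf)))"
      by (rule Cons.IH) (use Cons.prems in auto)
    show ?case
    proof (cases "fst p")
      case False
      then have "slot y p = snd p" for y
        by (simp add: slot_def)
      then show ?thesis using IH by simp
    next
      case True
      \<comment> \<open>the entries of \<open>suf\<close>, already moved by \<open>a\<close>\<close>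
      define sh where "sh = (\<lambda>q :: bool \<times> 'a. (fst q, if fst q then snd q + a else snd q))"
      have sh: "map (slot x) (map sh suf) = map (slot (x + a)) suf" for x
        by (simp add: sh_def slot_def algebra_simps)
      have fsh: "length (filter fst (map sh suf)) = length (filter fst suf)"
        by (induction suf) (auto simp: sh_def)
      have "difference_degree (length (filter fst (pre @ (False, a) # map sh suf)))
          (\<lambda>x. A (map (slot x) (pre @ (False, a) # map sh suf)))"
        by (rule Suc.hyps(1)) (use Cons.prems True fsh in auto)
      then have "difference_degree m (\<lambda>x. A (map (slot x) pre @ a # map (slot (x + a)) suf))"
        using Cons.prems True fsh slot_const[of "(False, a)"]
        by (simp only: map_append list.map sh) simp
      from difference_degree_add[OF this IH]
      have "difference_degree m (\<lambda>x. A (map (slot x) pre @ a # map (slot (x + a)) suf) +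
         (A (map (slot x) pre @ slot x p # map (slot (x + a)) suf) - A (map (slot x) (pre @ p # suf))))"
        by simp
      moreover have "A (map (slot x) pre @ slot (x + a) p # map (slot (x + a)) suf) =
          A (map (slot x) pre @ a # map (slot (x + a)) suf) +
          A (map (slot x) pre @ slot x p # map (slot (x + a)) suf)" for x
      proof -
        \<comment> \<open>additivity in this slot splits off the term with the constant \<open>a\<close>\<close>
        have "slot (x + a) p = a + slot x p"
          using True by (simp add: slot_def algebra_simps)
        then show ?thesis
          using add[of "map (slot x) pre" "map (slot (x + a)) suf" a "slot x p"] Cons.prems by simp
      qed
      ultimately show ?thesis
        by (simp add: algebra_simps)
    qed
  qed
  have "difference_degree m (\<lambda>x. A (map (slot (x + a)) s) - A (map (slot x) s))" for a
    using telescope[of "[]" s a] Suc by simp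
  then show ?case
    unfolding Suc(2)[symmetric] difference_degree.simps by blast
qed

lemma difference_degree_diagonal:
  fixes A :: "'a::ab_group_add list \<Rightarrow> 'b::ab_group_add"
  assumes "\<And>ys u v zs. Suc (length ys + length zs) = n \<Longrightarrow>
      A (ys @ (u + v) # zs) = A (ys @ u # zs) + A (ys @ v # zs)"
  shows "difference_degree n (\<lambda>x. A (replicate n x))"
proof -
  have "difference_degree (length (filter fst (replicate n (True, 0 :: 'a))))
      (\<lambda>x. A (map (slot x) (replicate n (True, 0))))"
    using assms by (rule difference_degree_slots) simp_all
  then show ?thesis by (simp add: slot_def)
qed

text \<open>
A relation holds eventually if it holds between any two points of the same piece of some finite
cover of \<open>B\<close>. Convergence of \<open>f x - f y\<close> to 0 along this filter says that \<open>f\<close> maps \<open>B\<close> to a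
totally bounded set; as a filter, the notion admits the usual limit calculus.
\<close>

definition cover_filter :: "'a set \<Rightarrow> ('a \<times> 'a) filter" where
  "cover_filter B = Abs_filter (\<lambda>R. \<exists>C. finite C \<and> B \<subseteq> \<Union>C \<and> (\<forall>V\<in>C. \<forall>x\<in>V. \<forall>y\<in>V. R (x, y)))"

lemma eventually_cover_filter:
  "eventually R (cover_filter B) \<longleftrightarrow> (\<exists>C. finite C \<and> B \<subseteq> \<Union>C \<and> (\<forall>V\<in>C. \<forall>x\<in>V. \<forall>y\<in>V. R (x, y)))"
  unfolding cover_filter_def
proof (rule eventually_Abs_filter, rule is_filter.intro)
  show "\<exists>C. finite C \<and> B \<subseteq> \<Union>C \<and> (\<forall>V\<in>C. \<forall>x\<in>V. \<forall>y\<in>V. True)"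
    by (intro exI[of _ "{B}"]) simp
next
  fix R S :: "'a \<times> 'a \<Rightarrow> bool"
  assume "\<exists>C. finite C \<and> B \<subseteq> \<Union>C \<and> (\<forall>V\<in>C. \<forall>x\<in>V. \<forall>y\<in>V. R (x, y))"
    and "\<exists>C. finite C \<and> B \<subseteq> \<Union>C \<and> (\<forall>V\<in>C. \<forall>x\<in>V. \<forall>y\<in>V. S (x, y))"
  then show "\<exists>C. finite C \<and> B \<subseteq> \<Union>C \<and> (\<forall>V\<in>C. \<forall>x\<in>V. \<forall>y\<in>V. R (x, y) \<and> S (x, y))"
  proof (elim exE conjE)
    fix C D
    assume C: "finite C" "B \<subseteq> \<Union>C" "\<forall>V\<in>C. \<forall>x\<in>V. \<forall>y\<in>V. R (x, y)"
      and D: "finite D" "B \<subseteq> \<Union>D" "\<forall>V\<in>D. \<forall>x\<in>V. \<forall>y\<in>V. S (x, y)"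
    let ?K = "(\<lambda>(V, W). V \<inter> W) ` (C \<times> D)"
    have "finite ?K" using C(1) D(1) by simp
    moreover have "\<forall>V\<in>?K. \<forall>x\<in>V. \<forall>y\<in>V. R (x, y) \<and> S (x, y)"
      using C(3) D(3) by auto
    moreover have "B \<subseteq> \<Union>?K"
    proof
      fix x assume "x \<in> B"
      then obtain V W where "V \<in> C" "x \<in> V" "W \<in> D" "x \<in> W" using C(2) D(2) by (meson UnionE subsetD)
      then show "x \<in> \<Union>?K" by (intro UnionI[of "V \<inter> W"] image_eqI[of _ _ "(V, W)"]) auto
    qed
    ultimately show ?thesis
      by (intro exI[of _ ?K]) simp
  qed
next
  fix R S :: "'a \<times> 'a \<Rightarrow> bool"
  assume "\<forall>p. R p \<longrightarrow> S p" and "\<exists>C. finite C \<and> B \<subseteq> \<Union>C \<and> (\<forall>V\<in>C. \<forall>x\<in>V. \<forall>y\<in>V. R (x, y))"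
  then show "\<exists>C. finite C \<and> B \<subseteq> \<Union>C \<and> (\<forall>V\<in>C. \<forall>x\<in>V. \<forall>y\<in>V. S (x, y))"
    by metis
qed

lemma eventually_cover_filter_mem: "\<forall>\<^sub>F (x, y) in cover_filter B. x \<in> B \<and> y \<in> B"
  unfolding eventually_cover_filter by (auto intro!: exI[of _ "{B}"])

lemma cover_filter_image:
  assumes "eventually R (cover_filter (g ` B))"
  shows "\<forall>\<^sub>F (x, y) in cover_filter B. R (g x, g y)"
proof -
  obtain C where "finite C" "g ` B \<subseteq> \<Union>C" "\<forall>V\<in>C. \<forall>x\<in>V. \<forall>y\<in>V. R (x, y)"
    using assms unfolding eventually_cover_filter by blast
  moreover from this have "B \<subseteq> \<Union>((\<lambda>V. g -` V) ` C)"
    by (auto dest!: subsetD)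
  ultimately show ?thesis
    unfolding eventually_cover_filter by (intro exI[of _ "(\<lambda>V. g -` V) ` C"]) simp
qed

lemma cover_filter_precompact:
  fixes f :: "'a \<Rightarrow> 'b::real_normed_vector"
  assumes K: "compact K" and f: "f ` B \<subseteq> K"
  shows "((\<lambda>(x, y). f x - f y) \<longlongrightarrow> 0) (cover_filter B)"
proof (rule tendstoI)
  fix e :: real assume "0 < e"
  then obtain k where k: "finite k" "K \<subseteq> (\<Union>x\<in>k. ball x (e / 2))"
    using K unfolding compact_eq_totally_bounded by (metis half_gt_zero)
  have "dist (f x - f y) 0 < e" if "f x \<in> ball z (e / 2)" "f y \<in> ball z (e / 2)" for x y z
    using that dist_triangle_half_r[of z "f x" e "f y"] by (simp add: dist_norm)
  moreover have "B \<subseteq> \<Union>((\<lambda>z. f -` ball z (e / 2)) ` k)"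
    using k(2) f by (auto dest!: subsetD)
  ultimately show "\<forall>\<^sub>F p in cover_filter B. dist (case p of (x, y) \<Rightarrow> f x - f y) 0 < e"
    unfolding eventually_cover_filter
    using k(1) by (intro exI[of _ "(\<lambda>z. f -` ball z (e / 2)) ` k"]) force
qed

definition dual :: "('k::real_or_complex \<Rightarrow> 'a::real_normed_vector \<Rightarrow> 'a) \<Rightarrow> ('a \<Rightarrow> 'k) set" where
  "dual scl = dual_space scl UNIV norm"

lemma dual_iff:
  "f \<in> dual scl \<longleftrightarrow> (\<forall>x y. f (x + y) = f x + f y) \<and> (\<forall>c x. f (scl c x) = c * f x) \<and>
     (\<exists>C. \<forall>x. norm (f x) \<le> C * norm x)"
  by (simp add: dual_def dual_space_def)

lemma dual_diff: "f \<in> dual scl \<Longrightarrow> f (x - y) = f x - f y"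
  unfolding dual_iff by (metis add_diff_cancel_right' diff_add_cancel)

lemma dual_bounded:
  assumes "f \<in> dual scl"
  obtains C where "C > 0" "\<And>x. norm (f x) \<le> C * norm x"
proof -
  obtain C where C: "\<And>x. norm (f x) \<le> C * norm x"
    using assms unfolding dual_iff by blast
  have "norm (f x) \<le> (max C 1) * norm x" for x
    using C[of x] by (rule order_trans) (simp add: mult_right_mono)
  then show ?thesis using that[of "max C 1"] by simp
qed

lemma dual_continuous: 
  assumes "f \<in> dual scl"
  shows "continuous_on S f"
proof -
  obtain C where "C > 0" and C: "\<And>x. norm (f x) \<le> C * norm x"
    using dual_bounded[OF assms] by blast
  have "C-lipschitz_on S f"
    by (rule lipschitz_onI) (use C \<open>C > 0\<close> dual_diff[OF assms] in \<open>auto simp: dist_norm simp flip: dual_diff[OF assms]\<close>)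
  then show ?thesis by (rule lipschitz_on_continuous_on)
qed

lemma weakly_cont_on_bounded_difference:
  assumes P: "weakly_cont_on_bounded scl P"
  shows "weakly_cont_on_bounded scl (\<lambda>x. P (x + a) - P x)"
  unfolding weakly_cont_on_bounded_def
proof (intro allI impI)
  fix G B b
  assume B: "bounded B" "eventually (\<lambda>x. x \<in> B) G" and w: "weakly_converges scl G b"
  have "weakly_converges scl (filtermap (\<lambda>x. x + a) G) (b + a)"
    using w unfolding weakly_converges_def
    by (auto simp: filterlim_filtermap dual_space_def intro!: tendsto_add)
  moreover have "bounded ((\<lambda>x. x + a) ` B)"
    using B(1) bounded_translation[of B a] by (simp add: add.commute)
  moreover have "eventually (\<lambda>x. x \<in> (\<lambda>x. x + a) ` B) (filtermap (\<lambda>x. x + a) G)"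
    using B(2) by (auto simp: eventually_filtermap elim: eventually_mono)
  ultimately have "(P \<longlongrightarrow> P (b + a)) (filtermap (\<lambda>x. x + a) G)"
    using P unfolding weakly_cont_on_bounded_def by blast
  moreover have "(P \<longlongrightarrow> P b) G"
    using P B w unfolding weakly_cont_on_bounded_def by blast
  ultimately show "((\<lambda>x. P (x + a) - P x) \<longlongrightarrow> P (b + a) - P b) G"
    by (intro tendsto_diff) (simp_all add: filterlim_filtermap)
qed

text \<open>
Every functional is bounded on \<open>B\<close>, so its range there is totally bounded and the differences
\<open>x - y\<close> tend weakly to 0 along the cover filter. They form a bounded net, and weak continuity
at the single point 0 applies.
\<close>

lemma weakly_cont_increment:
  fixes P :: "'a::real_normed_vector \<Rightarrow> 'b::real_normed_vector"
    and scl :: "'k::real_or_complex \<Rightarrow> 'a \<Rightarrow> 'a"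
  assumes P: "weakly_cont_on_bounded scl P" and B: "bounded B"
  shows "((\<lambda>(x, y). P (x - y)) \<longlongrightarrow> P 0) (cover_filter B)"
proof -
  let ?G = "filtermap (\<lambda>(x, y). x - y) (cover_filter B)"
  have "((\<lambda>(x, y). f x - f y) \<longlongrightarrow> 0) (cover_filter B)" if f: "f \<in> dual scl" for f
  proof -
    obtain C where "C > 0" and C: "\<And>x. norm (f x) \<le> C * norm x"
      using dual_bounded[OF f] by blast
    obtain R where R: "\<forall>x\<in>B. norm x \<le> R"
      using B bounded_iff by blast
    have "f ` B \<subseteq> cball 0 (C * R)"
    proof clarsimp
      fix x assume "x \<in> B"
      then have "C * norm x \<le> C * R" using R \<open>C > 0\<close> by simp
      with C[of x] show "norm (f x) \<le> C * R" by linarith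
    qed
    then show ?thesis
      by (rule cover_filter_precompact[OF compact_cball_scalars])
  qed
  then have "((\<lambda>p. f (fst p - snd p)) \<longlongrightarrow> f 0) (cover_filter B)" if "f \<in> dual scl" for f
    using that dual_diff[OF that, of 0 0] by (simp add: case_prod_unfold dual_diff[OF that])
  then have "weakly_converges scl ?G 0"
    unfolding weakly_converges_def dual_def[symmetric]
    by (simp add: filterlim_filtermap case_prod_unfold)
  moreover have "bounded ((\<lambda>(x, y). x - y) ` (B \<times> B))"
    using bounded_minus[OF B B] .
  moreover have "eventually (\<lambda>z. z \<in> (\<lambda>(x, y). x - y) ` (B \<times> B)) ?G"
    unfolding eventually_filtermap using eventually_cover_filter_mem
    by (rule eventually_mono) auto
  ultimately have "(P \<longlongrightarrow> P 0) ?G"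
    using P unfolding weakly_cont_on_bounded_def by blast
  then show ?thesis
    by (simp add: filterlim_filtermap case_prod_unfold)
qed

text \<open>
Weak continuity on bounded sets forces a polynomial to map bounded sets to totally bounded sets.
Given a piece \<open>V\<close> of a fine cover and a point \<open>a\<close> of \<open>V\<close>, write \<open>P x\<close> as the value of \<open>P\<close> at the
weakly small increment \<open>x - a\<close>, which is close to \<open>P 0\<close>, plus the difference of \<open>P\<close> in direction
\<open>a\<close>, taken at \<open>x - a\<close>. The latter has smaller degree, so induction applies to it after \<open>a\<close> has been
fixed; only finitely many points \<open>a\<close> occur.
\<close>

theorem weakly_uniformly_continuous_on_bounded:
  fixes P :: "'a::real_normed_vector \<Rightarrow> 'b::real_normed_vector"
    and scl :: "'k::real_or_complex \<Rightarrow> 'a \<Rightarrow> 'a"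
  assumes "difference_degree n P" "weakly_cont_on_bounded scl P" "bounded B"
  shows "((\<lambda>(x, y). P x - P y) \<longlongrightarrow> 0) (cover_filter B)"
  using assms
proof (induction n arbitrary: P B)
  case 0
  then have "P x = P y" for x y
    by (metis add.commute difference_degree.simps(1) diff_add_cancel)
  then have "P x - P y = 0" for x y unfolding right_minus_eq .
  then have "(\<lambda>(x, y). P x - P y) = (\<lambda>p. 0)" by (auto simp del: right_minus_eq)
  then show ?case by simp
next
  case (Suc n)
  show ?case
  proof (rule tendstoI)
    fix e :: real assume e: "0 < e"
    have "\<forall>\<^sub>F (x, y) in cover_filter B. dist (P (x - y)) (P 0) < e / 3"
      using tendstoD[OF weakly_cont_increment[OF Suc.prems(2,3)], of "e / 3"] e
      by (simp add: case_prod_unfold)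
    then obtain C where C: "finite C" "B \<subseteq> \<Union>C"
      and small: "\<And>V x y. V \<in> C \<Longrightarrow> x \<in> V \<Longrightarrow> y \<in> V \<Longrightarrow> dist (P (x - y)) (P 0) < e / 3"
      unfolding eventually_cover_filter by force
    define a where "a = (\<lambda>V :: 'a set. SOME x. x \<in> V)"
    have a: "a V \<in> V" if "x \<in> V" for x V
      unfolding a_def using that by (rule someI)
    define Q where "Q = (\<lambda>V z. P (z + a V) - P z)"
    have "((\<lambda>(x, y). Q V x - Q V y) \<longlongrightarrow> 0) (cover_filter ((\<lambda>x. x - a V) ` B))" for V
    proof (rule Suc.IH)
      show "difference_degree n (Q V)" using Suc.prems by (simp add: Q_def)
      show "weakly_cont_on_bounded scl (Q V)"
        unfolding Q_def using Suc.prems(2) by (rule weakly_cont_on_bounded_difference)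
      show "bounded ((\<lambda>x. x - a V) ` B)"
        using Suc.prems(3) by (rule bounded_translation_minus)
    qed
    then have "\<forall>\<^sub>F p in cover_filter ((\<lambda>x. x - a V) ` B). dist (case p of (x, y) \<Rightarrow> Q V x - Q V y) 0 < e / 3" for V
      using e by (intro tendstoD) auto
    from cover_filter_image[OF this]
    have "\<forall>\<^sub>F (x, y) in cover_filter B. norm (Q V (x - a V) - Q V (y - a V)) < e / 3" for V
      by simp
    then have "\<forall>\<^sub>F p in cover_filter B. \<forall>V\<in>C. norm (Q V (fst p - a V) - Q V (snd p - a V)) < e / 3"
      using C(1) by (intro eventually_ball_finite) (auto simp: case_prod_unfold)
    moreover have "\<forall>\<^sub>F p in cover_filter B. \<exists>V\<in>C. fst p \<in> V \<and> snd p \<in> V"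
      unfolding eventually_cover_filter using C by (intro exI[of _ C]) auto
    ultimately show "\<forall>\<^sub>F p in cover_filter B. dist (case p of (x, y) \<Rightarrow> P x - P y) 0 < e"
    proof eventually_elim
      case (elim p)
      then obtain V where V: "V \<in> C" "fst p \<in> V" "snd p \<in> V"
        and Q: "norm (Q V (fst p - a V) - Q V (snd p - a V)) < e / 3" by blast
      let ?u = "P (fst p - a V) - P 0" and ?v = "P (snd p - a V) - P 0"
      have uv: "norm ?u < e / 3" "norm ?v < e / 3"
        using small[OF V(1) V(2) a[OF V(2)]] small[OF V(1) V(3) a[OF V(2)]] by (auto simp: dist_norm)
      have "P (fst p) - P (snd p) = (Q V (fst p - a V) - Q V (snd p - a V)) + (?u - ?v)"
        by (simp add: Q_def)
      also have "norm \<dots> \<le> norm (Q V (fst p - a V) - Q V (snd p - a V)) + (norm ?u + norm ?v)"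
        by (intro norm_triangle_le add_left_mono norm_triangle_ineq4)
      also have "\<dots> < e"
        using Q uv by linarith
      finally show ?case by (simp add: case_prod_unfold)
    qed
  qed
qed

section \<open>Coordinates modulo a closed subspace of finite codimension\<close>

lemma scalars_Cauchy_converges:
  fixes c :: "nat \<Rightarrow> 'k::real_or_complex"
  assumes "Cauchy c"
  shows "\<exists>l. c \<longlonglongrightarrow> l"
proof -
  obtain r where "\<forall>n. norm (c n) \<le> r"
    using cauchy_imp_bounded[OF assms] unfolding bounded_iff by blast
  then have "\<forall>n. c n \<in> cball 0 r" by simp
  moreover have "complete (cball 0 r :: 'k set)"
    using compact_cball_scalars by (rule compact_imp_complete)
  ultimately show ?thesis
    using assms unfolding complete_def by blast
qed

context banach_over
begin

lemma norm_scale_diff: "norm (scl c x - scl c y) = norm c * norm (x - y)"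
  by (metis norm_scale scale_right_diff_distrib)

lemma continuous_scale: "continuous_on S (scl c)"
proof (rule lipschitz_on_continuous_on)
  show "(norm c)-lipschitz_on S (scl c)"
    by (rule lipschitz_onI) (simp_all add: dist_norm norm_scale_diff)
qed

lemma tendsto_scale: 
  assumes "(c \<longlongrightarrow> l) G" shows "((\<lambda>i. scl (c i) x) \<longlongrightarrow> scl l x) G"
proof (rule iffD2[OF tendsto_dist_iff])
  have "dist (scl (c i) x) (scl l x) = dist (c i) l * norm x" for i
    by (simp add: dist_norm norm_scale scale_left_diff_distrib[symmetric])
  moreover have "((\<lambda>i. dist (c i) l * norm x) \<longlongrightarrow> 0 * norm x) G"
    using assms by (intro tendsto_mult_right) (simp add: tendsto_dist_iff[symmetric])
  ultimately show "((\<lambda>i. dist (scl (c i) x) (scl l x)) \<longlongrightarrow> 0) G" by simp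
qed

lemma subspace_closure:
  assumes H: "subspace H"
  shows "subspace (closure H)"
proof (rule subspaceI)
  show "0 \<in> closure H"
    using closure_subset subspace_0[OF H] by blast
next
  fix x y assume "x \<in> closure H" "y \<in> closure H"
  then obtain a b where "\<forall>n. a n \<in> H" "a \<longlonglongrightarrow> x" "\<forall>n. b n \<in> H" "b \<longlonglongrightarrow> y"
    unfolding closure_sequential by blast
  then show "x + y \<in> closure H"
    unfolding closure_sequential
    by (intro exI[of _ "\<lambda>n. a n + b n"]) (auto intro: tendsto_add subspace_add[OF H])
next
  fix c x assume "x \<in> closure H"
  then obtain a where "\<forall>n. a n \<in> H" "a \<longlonglongrightarrow> x"
    unfolding closure_sequential by blast
  then show "scl c x \<in> closure H"
    unfolding closure_sequential
    by (intro exI[of _ "\<lambda>n. scl c (a n)"])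
      (auto intro: subspace_scale[OF H] continuous_on_tendsto_compose[OF continuous_scale[of UNIV]])
qed

text \<open>
Adding a vector \<open>b\<close> outside a closed subspace \<open>H\<close> keeps it closed, and the \<open>b\<close>-coordinate is
bounded: if \<open>d\<close> is a positive lower bound for the distances from \<open>b\<close> to points of \<open>H\<close>, then a vector with
coordinate \<open>k\<close> has norm at least \<open>d * norm k\<close>. Closedness follows, as the coordinates of a
convergent sequence then form a Cauchy sequence of scalars.
\<close>

lemma closed_subspace_adjoin:
  assumes H: "subspace H" "closed H" and b: "b \<notin> H"
  obtains \<psi> C where "closed (span (insert b H))"
    "\<And>w. w \<in> span (insert b H) \<Longrightarrow> w - scl (\<psi> w) b \<in> H"
    "\<And>w k. w - scl k b \<in> H \<Longrightarrow> \<psi> w = k"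
    "C > 0" "\<And>w. w \<in> span (insert b H) \<Longrightarrow> norm (\<psi> w) \<le> C * norm w"
proof -
  define \<psi> where "\<psi> w = (SOME k. w - scl k b \<in> H)" for w
  have spanH: "span H = H" using H(1) by (simp add: span_eq_iff)
  have \<psi>: "w - scl (\<psi> w) b \<in> H" if "w \<in> span (insert b H)" for w
  proof -
    have "\<exists>k. w - scl k b \<in> H" using that by (simp add: span_breakdown_eq spanH)
    then show ?thesis unfolding \<psi>_def by (rule someI_ex)
  qed
  have zero: "k = 0" if "scl k b \<in> H" for k
  proof (rule ccontr)
    assume "k \<noteq> 0"
    then have "b = scl (inverse k) (scl k b)" by simp
    then show False using subspace_scale[OF H(1) that] b by metis
  qed
  have unique: "\<psi> w = k" if "w - scl k b \<in> H" for w k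
  proof -
    have "w - scl (\<psi> w) b \<in> H" unfolding \<psi>_def using that by (rule someI)
    from subspace_diff[OF H(1) that this] have "scl (\<psi> w - k) b \<in> H"
      by (simp add: scale_left_diff_distrib)
    with zero show ?thesis by fastforce
  qed
  obtain d where d: "d > 0" "\<And>h. h \<in> H \<Longrightarrow> d \<le> norm (b - h)"
  proof -
    have "open (- H)" "b \<in> - H" using H b by auto
    then obtain e where "e > 0" "ball b e \<subseteq> - H" by (meson open_contains_ball)
    then show ?thesis using that[of e] by (force simp: dist_norm)
  qed
  have bound: "norm (\<psi> w) \<le> (1 / d) * norm w" if w: "w \<in> span (insert b H)" for w
  proof (cases "\<psi> w = 0")
    case False
    let ?k = "\<psi> w"
    have "scl (- inverse ?k) (w - scl ?k b) \<in> H"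
      using \<psi>[OF w] by (rule subspace_scale[OF H(1)])
    then have "d \<le> norm (b - scl (- inverse ?k) (w - scl ?k b))" by (rule d)
    also have "b - scl (- inverse ?k) (w - scl ?k b) = scl (inverse ?k) w"
      using False by (simp add: scale_right_diff_distrib)
    also have "norm \<dots> = norm w / norm ?k" by (simp add: norm_scale norm_inverse divide_inverse mult.commute)
    finally show ?thesis using False d(1) by (simp add: field_simps)
  qed (use d in simp)
  have "closed (span (insert b H))"
    unfolding closed_sequential_limits
  proof (intro allI impI, elim conjE)
    fix w l assume w: "\<forall>n. w n \<in> span (insert b H)" and l: "w \<longlonglongrightarrow> l"
    have \<psi>diff: "\<psi> (w m - w n) = \<psi> (w m) - \<psi> (w n)" for m n
    proof (rule unique)
      have "(w m - scl (\<psi> (w m)) b) - (w n - scl (\<psi> (w n)) b) \<in> H"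
        using w by (intro subspace_diff[OF H(1)] \<psi>) auto
      then show "w m - w n - scl (\<psi> (w m) - \<psi> (w n)) b \<in> H"
        by (simp add: scale_left_diff_distrib algebra_simps)
    qed
    have "Cauchy (\<lambda>n. \<psi> (w n))"
    proof (rule CauchyI)
      fix e :: real assume "0 < e"
      then obtain N where N: "\<And>m n. m \<ge> N \<Longrightarrow> n \<ge> N \<Longrightarrow> norm (w m - w n) < e * d"
        using CauchyD[OF LIMSEQ_imp_Cauchy[OF l], of "e * d"] d(1) by auto
      have "norm (\<psi> (w m) - \<psi> (w n)) < e" if "m \<ge> N" "n \<ge> N" for m n
      proof -
        have "norm (\<psi> (w m - w n)) \<le> (1 / d) * norm (w m - w n)"
          using w by (intro bound span_diff) auto
        also have "\<dots> < (1 / d) * (e * d)"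
          using N[OF that] d(1) by (intro mult_strict_left_mono) auto
        finally show ?thesis using d(1) by (simp add: \<psi>diff)
      qed
      then show "\<exists>N. \<forall>m\<ge>N. \<forall>n\<ge>N. norm (\<psi> (w m) - \<psi> (w n)) < e" by blast
    qed
    then obtain k where "(\<lambda>n. \<psi> (w n)) \<longlonglongrightarrow> k"
      using scalars_Cauchy_converges by blast
    then have "(\<lambda>n. w n - scl (\<psi> (w n)) b) \<longlonglongrightarrow> l - scl k b"
      by (intro tendsto_diff l tendsto_scale)
    then have "l - scl k b \<in> H"
      by (rule closed_sequentially[OF H(2), rotated]) (use \<psi> w in blast)
    then show "l \<in> span (insert b H)"
      unfolding span_breakdown_eq spanH by blast
  qed
  then show ?thesis
    using that[of \<psi> "1 / d"] \<psi> unique bound d(1) by simp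
qed

text \<open>
Continuous coordinates in the finite dimensional quotient by \<open>H\<close>. They are constructed one
vector at a time by the preceding lemma, without extending functionals: the coordinates for
\<open>H\<close> enlarged by \<open>b\<close> map every vector into this larger subspace, where the coordinate of \<open>b\<close> is known.
\<close>

lemma closed_finite_codim_coordinates:
  assumes "finite B" "subspace H" "closed H" "span (H \<union> B) = UNIV"
  shows "\<exists>\<phi>. (\<forall>b\<in>B. \<phi> b \<in> dual scl) \<and> (\<forall>z. z - (\<Sum>b\<in>B. scl (\<phi> b z) b) \<in> H)"
  using assms
proof (induction B arbitrary: H rule: finite_induct)
  case empty
  then have "H = UNIV" by (metis span_eq_iff sup_bot.right_neutral)
  then show ?case by simp
next
  case (insert b B)
  have ext: "(\<Sum>x\<in>insert b B. scl ((\<phi>(b := f)) x z) x) = scl (f z) b + (\<Sum>x\<in>B. scl (\<phi> x z) x)" for \<phi> f z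
  proof -
    have "(\<Sum>x\<in>B. scl ((\<phi>(b := f)) x z) x) = (\<Sum>x\<in>B. scl (\<phi> x z) x)"
      using insert.hyps by (intro sum.cong) auto
    then show ?thesis using insert.hyps by simp
  qed
  show ?case
  proof (cases "b \<in> H")
    case True
    then have "span (H \<union> B) = UNIV"
      using insert.prems(3) by (simp add: insert_absorb)
    from insert.IH[OF insert.prems(1,2) this] obtain \<phi> where
      \<phi>: "\<forall>b\<in>B. \<phi> b \<in> dual scl" "\<forall>z. z - (\<Sum>b\<in>B. scl (\<phi> b z) b) \<in> H" by blast
    have "(\<lambda>x. 0) \<in> dual scl" by (auto simp: dual_iff intro: exI[of _ 0])
    then show ?thesis
      using \<phi> by (intro exI[of _ "\<phi>(b := \<lambda>x. 0)"] conjI allI) (simp_all only: ext, auto)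
  next
    case False
    let ?H = "span (insert b H)"
    obtain \<psi> C where cl: "closed ?H" and \<psi>: "\<And>w. w \<in> ?H \<Longrightarrow> w - scl (\<psi> w) b \<in> H"
      and unique: "\<And>w k. w - scl k b \<in> H \<Longrightarrow> \<psi> w = k"
      and C: "C > 0" "\<And>w. w \<in> ?H \<Longrightarrow> norm (\<psi> w) \<le> C * norm w"
      using closed_subspace_adjoin[OF insert.prems(1,2) False] by blast
    have "H \<union> insert b B \<subseteq> ?H \<union> B"
      by (auto intro: span_base)
    then have "span (?H \<union> B) = UNIV"
      using span_mono insert.prems(3) by blast
    from insert.IH[OF subspace_span cl this] obtain \<phi> where
      \<phi>: "\<And>x. x \<in> B \<Longrightarrow> \<phi> x \<in> dual scl" and r: "\<And>z. z - (\<Sum>b\<in>B. scl (\<phi> b z) b) \<in> ?H" by blast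
    define R where "R z = z - (\<Sum>b\<in>B. scl (\<phi> b z) b)" for z
    have RH: "R z - scl (\<psi> (R z)) b \<in> H" for z
      using r \<psi> by (simp add: R_def)
    have Radd: "R (x + y) = R x + R y" for x y
    proof -
      have "(\<Sum>b\<in>B. scl (\<phi> b (x + y)) b) = (\<Sum>b\<in>B. scl (\<phi> b x) b + scl (\<phi> b y) b)"
        using \<phi> by (intro sum.cong) (auto simp: dual_iff scale_left_distrib)
      then show ?thesis by (simp add: R_def sum.distrib)
    qed
    have Rscale: "R (scl c x) = scl c (R x)" for c x
    proof -
      have "(\<Sum>b\<in>B. scl (\<phi> b (scl c x)) b) = (\<Sum>b\<in>B. scl c (scl (\<phi> b x) b))"
        using \<phi> by (intro sum.cong) (auto simp: dual_iff)
      then show ?thesis by (simp add: R_def scale_sum_right scale_right_diff_distrib)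
    qed
    have "\<exists>C. \<forall>z. norm (\<phi> x z) \<le> C * norm z" if "x \<in> B" for x
      using \<phi>[OF that] by (simp add: dual_iff)
    then obtain K where K: "\<And>x z. x \<in> B \<Longrightarrow> norm (\<phi> x z) \<le> K x * norm z" by metis
    define M where "M = 1 + (\<Sum>x\<in>B. K x * norm x)"
    have Rbound: "norm (R z) \<le> M * norm z" for z
    proof -
      have "norm (R z) \<le> norm z + norm (\<Sum>b\<in>B. scl (\<phi> b z) b)"
        unfolding R_def by (rule norm_triangle_ineq4)
      also have "norm (\<Sum>b\<in>B. scl (\<phi> b z) b) \<le> (\<Sum>x\<in>B. (K x * norm x) * norm z)"
      proof (rule sum_norm_le)
        fix x assume "x \<in> B"
        then have "norm (\<phi> x z) * norm x \<le> (K x * norm z) * norm x"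
          using K by (intro mult_right_mono) auto
        then show "norm (scl (\<phi> x z) x) \<le> (K x * norm x) * norm z"
          by (simp add: norm_scale mult_ac)
      qed
      finally show ?thesis by (simp only: M_def distrib_right mult_1 sum_distrib_right)
    qed
    have "(\<lambda>z. \<psi> (R z)) \<in> dual scl"
      unfolding dual_iff
    proof (intro conjI allI exI[of _ "C * M"])
      show "\<psi> (R (x + y)) = \<psi> (R x) + \<psi> (R y)" for x y
      proof (rule unique)
        show "R (x + y) - scl (\<psi> (R x) + \<psi> (R y)) b \<in> H"
          using subspace_add[OF insert.prems(1) RH[of x] RH[of y]]
          by (simp add: Radd scale_left_distrib algebra_simps)
      qed
      show "\<psi> (R (scl c x)) = c * \<psi> (R x)" for c x
      proof (rule unique)
        show "R (scl c x) - scl (c * \<psi> (R x)) b \<in> H"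
          using subspace_scale[OF insert.prems(1) RH[of x], of c]
          by (simp add: Rscale scale_right_diff_distrib)
      qed
      show "norm (\<psi> (R x)) \<le> C * M * norm x" for x
      proof -
        have "norm (\<psi> (R x)) \<le> C * norm (R x)" using C(2) r by (simp add: R_def)
        also have "\<dots> \<le> C * (M * norm x)" using C(1) Rbound by simp
        finally show ?thesis by simp
      qed
    qed
    moreover have "z - (scl (\<psi> (R z)) b + (\<Sum>x\<in>B. scl (\<phi> x z) x)) \<in> H" for z
      using RH[of z] by (simp add: R_def algebra_simps)
    ultimately show ?thesis
      using \<phi> by (intro exI[of _ "\<phi>(b := \<lambda>z. \<psi> (R z))"] conjI allI) (simp_all only: ext, auto)
  qed
qed

end

section \<open>Asymptotic smoothness\<close>

context banach_over
begin

lemma compact_operator_add: "compact_operator scl T \<Longrightarrow> T (x + y) = T x + T y"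
  and compact_operator_scale: "compact_operator scl T \<Longrightarrow> T (scl c x) = scl c (T x)"
  by (simp_all add: compact_operator_def Vector_Spaces.linear_iff)

lemma compact_operator_bounded_linear:
  assumes T: "compact_operator scl T"
  shows "bounded_linear T"
proof -
  note add = compact_operator_add[OF T] and scale = compact_operator_scale[OF T]
  have "bounded (T ` cball 0 1)"
    using T compact_imp_bounded bounded_subset[OF _ closure_subset] unfolding compact_operator_def by blast
  then obtain K where K: "\<And>x. norm x \<le> 1 \<Longrightarrow> norm (T x) \<le> K"
    unfolding bounded_iff by force
  have real: "T (r *\<^sub>R x) = r *\<^sub>R T x" for r x
    using scale[of "of_real r" x] by (simp add: scale_of_real)
  show ?thesis
  proof (rule bounded_linear_intro[of T K])
    fix x show "norm (T x) \<le> norm x * K"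
    proof (cases "x = 0")
      case True
      then show ?thesis using real[of 0 0] by simp
    next
      case False
      then have "norm (T ((1 / norm x) *\<^sub>R x)) \<le> K" by (intro K) simp
      then show ?thesis using False by (simp add: real field_simps)
    qed
  qed (simp_all add: add real)
qed

text \<open>
The infimum defining the modulus runs over all subspaces of finite codimension, whereas continuous
coordinates need a closed one. Passing to the closure is harmless because the norm bound on \<open>h\<close>
is strict here, hence inherited by approximating vectors.
\<close>

lemma smooth_closed_subspace:
  assumes y: "norm y = 1" and t: "t > 0" and s: "smooth_modulus scl t < s"
  obtains H B where "subspace H" "closed H" "finite B" "span (H \<union> B) = UNIV"
    "\<And>h. h \<in> H \<Longrightarrow> norm h < t \<Longrightarrow> norm (y + h) \<le> 1 + s"
proof -
  define S where "S x H = (SUP h\<in>{h\<in>H. norm h \<le> t}. norm (x + h))" for x :: 'a and H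
  let ?FC = "{H. finite_codim_subspace scl H}"
  have bdd: "bdd_above ((\<lambda>h. norm (x + h)) ` {h\<in>H. norm h \<le> t})" for x :: 'a and H
    by (rule bdd_aboveI2[of _ _ "norm x + t"]) (auto intro: order_trans[OF norm_triangle_ineq])
  have low: "norm x \<le> S x H" if "H \<in> ?FC" for x H
    unfolding S_def using that t subspace_0
    by (intro cSUP_upper2[OF bdd, of 0]) (auto simp: finite_codim_subspace_def)
  have UNIV: "UNIV \<in> ?FC"
    by (auto simp: finite_codim_subspace_def subspace_UNIV intro!: exI[of _ "{}"])
  have below: "bdd_below (S x ` ?FC)" for x
    using low by (intro bdd_belowI2) auto
  have at: "smooth_modulus_at scl t x = (INF H\<in>?FC. S x H) - 1" for x
    by (simp add: smooth_modulus_at_def S_def)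
  have "smooth_modulus_at scl t x \<le> t" if "x \<in> sphere 0 1" for x
  proof -
    have "(INF H\<in>?FC. S x H) \<le> S x UNIV"
      by (rule cINF_lower[OF below UNIV])
    also have "\<dots> \<le> norm x + t"
      unfolding S_def using t
      by (intro cSUP_least) (auto intro: order_trans[OF norm_triangle_ineq] exI[of _ 0])
    finally show ?thesis using that by (simp add: at)
  qed
  then have "smooth_modulus_at scl t y \<le> smooth_modulus scl t"
    unfolding smooth_modulus_def using y by (intro cSUP_upper bdd_aboveI2) auto
  with s have "(INF H\<in>?FC. S y H) < 1 + s" by (simp add: at)
  then obtain H where H: "H \<in> ?FC" "S y H < 1 + s"
    using cINF_less_iff[OF _ below[of y]] UNIV by blast
  then obtain B where B: "finite B" "span (H \<union> B) = UNIV" and sub: "subspace H"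
    unfolding finite_codim_subspace_def by blast
  show ?thesis
  proof (rule that[of "closure H" B])
    show "span (closure H \<union> B) = UNIV"
      using B(2) span_mono[of "H \<union> B" "closure H \<union> B"] closure_subset[of H] by blast
    fix h assume "h \<in> closure H" "norm h < t"
    then obtain a where a: "\<forall>n. a n \<in> H" "a \<longlonglongrightarrow> h"
      unfolding closure_sequential by blast
    then have "(\<lambda>n. norm (a n)) \<longlonglongrightarrow> norm h" by (intro tendsto_norm)
    then have "eventually (\<lambda>n. norm (a n) < t) sequentially"
      using \<open>norm h < t\<close> by (rule order_tendstoD)
    then have "eventually (\<lambda>n. norm (y + a n) \<le> 1 + s) sequentially"
    proof eventually_elim
      case (elim n)
      then have "norm (y + a n) \<le> S y H"
        unfolding S_def using a(1) by (intro cSUP_upper bdd) auto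
      with H(2) show ?case by simp
    qed
    moreover have "(\<lambda>n. norm (y + a n)) \<longlonglongrightarrow> norm (y + h)"
      by (intro tendsto_intros a)
    ultimately show "norm (y + h) \<le> 1 + s"
      by (intro tendsto_upperbound) auto
  qed (use B sub in \<open>auto intro: subspace_closure\<close>)
qed

lemma small_smooth_modulus:
  assumes "asymptotically_uniformly_smooth scl" and "\<kappa> > 0"
  obtains t where "t > 0" "smooth_modulus scl t < \<kappa> * t"
proof -
  have "eventually (\<lambda>t. smooth_modulus scl t / t < \<kappa>) (at_right 0)"
    using assms unfolding asymptotically_uniformly_smooth_def by (rule order_tendstoD)
  moreover have "eventually (\<lambda>t::real. t > 0) (at_right 0)"
    by (simp add: eventually_at_right_less)
  ultimately have "eventually (\<lambda>t. t > 0 \<and> smooth_modulus scl t < \<kappa> * t) (at_right 0)"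
    by eventually_elim (simp add: field_simps)
  then show ?thesis
    using that eventually_happens'[OF trivial_limit_at_right_real] by blast
qed

text \<open>
Smoothness provides enough functionals to separate points: if a unit vector \<open>u\<close> belonged to a
subspace \<open>H\<close> on which \<open>norm (u + h)\<close> grows more slowly than \<open>1 + norm h\<close>, the multiples \<open>h\<close> of \<open>u\<close>
itself would contradict this. So \<open>u\<close> is not in \<open>H\<close>, and one of the coordinates modulo \<open>H\<close> does not
vanish at \<open>u\<close>.
\<close>

lemma asymptotically_uniformly_smooth_separates:
  assumes smooth: "asymptotically_uniformly_smooth scl" and "y \<noteq> 0"
  shows "\<exists>f\<in>dual scl. f y \<noteq> 0"
proof -
  define u where "u = (1 / norm y) *\<^sub>R y"
  have u: "norm u = 1" using \<open>y \<noteq> 0\<close> by (simp add: u_def)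
  have yu: "y = scl (of_real (norm y)) u" using \<open>y \<noteq> 0\<close> by (simp add: u_def scale_of_real)
  obtain t where t: "t > 0" "smooth_modulus scl t < (1/2) * t"
    using small_smooth_modulus[OF smooth, of "1/2"] by auto
  obtain H B where H: "subspace H" "closed H" "finite B" "span (H \<union> B) = UNIV"
    and uH: "\<And>h. h \<in> H \<Longrightarrow> norm h < t \<Longrightarrow> norm (u + h) \<le> 1 + (1/2) * t"
    using smooth_closed_subspace[OF u t] by blast
  have "u \<notin> H"
  proof
    assume "u \<in> H"
    then have "(3/4 * t) *\<^sub>R u \<in> H"
      using subspace_scale[OF H(1), of u "of_real (3/4 * t)"] by (simp only: scale_of_real)
    then have "norm (u + (3/4 * t) *\<^sub>R u) \<le> 1 + (1/2) * t"
      by (rule uH) (use u t in simp)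
    also have "u + (3/4 * t) *\<^sub>R u = (1 + 3/4 * t) *\<^sub>R u" by (simp add: scaleR_left_distrib)
    finally show False using u t by simp
  qed
  obtain \<phi> where \<phi>: "\<forall>b\<in>B. \<phi> b \<in> dual scl" "\<forall>z. z - (\<Sum>b\<in>B. scl (\<phi> b z) b) \<in> H"
    using closed_finite_codim_coordinates[OF H(3,1,2,4)] by blast
  have "\<exists>b\<in>B. \<phi> b u \<noteq> 0"
  proof (rule ccontr)
    assume "\<not> (\<exists>b\<in>B. \<phi> b u \<noteq> 0)"
    then have "(\<Sum>b\<in>B. scl (\<phi> b u) b) = 0" by (intro sum.neutral) simp
    then show False using \<phi>(2) \<open>u \<notin> H\<close> by (metis diff_zero)
  qed
  then obtain b where b: "b \<in> B" "\<phi> b u \<noteq> 0" by blast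
  have "\<phi> b y = of_real (norm y) * \<phi> b u"
    using \<phi>(1) b(1) yu unfolding dual_iff by metis
  then have "\<phi> b y \<noteq> 0" using b(2) \<open>y \<noteq> 0\<close> by simp
  then show ?thesis using b(1) \<phi>(1) by blast
qed

end

locale smooth_approximation = banach_over +
  fixes L :: "'i \<Rightarrow> 'b \<Rightarrow> 'b" and F :: "'i filter"
  assumes smooth: "asymptotically_uniformly_smooth scl"
    and approx: "shrinking_metric_compact_approx scl F L"
    and compl: "onorm (\<lambda>x. x - L i x) \<le> 1"
    and infinite_dim: "infinite_dimensional scl"
begin

lemma compact_L: "compact_operator scl (L i)"
  and onorm_L: "onorm (L i) \<le> 1"
  and F_nontrivial: "F \<noteq> bot"
  and L_tendsto: "((\<lambda>i. L i x) \<longlongrightarrow> x) F"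
  using approx unfolding shrinking_metric_compact_approx_def metric_compact_approx_def by blast+

lemma bounded_linear_L: "bounded_linear (L i)"
  using compact_L by (rule compact_operator_bounded_linear)

lemma norm_L: "norm (L i x) \<le> norm x"
  using onorm[OF bounded_linear_L, of i x] mult_right_mono[OF onorm_L, of "norm x" i] by simp

lemma norm_compl: "norm (x - L i x) \<le> norm x"
proof -
  have "bounded_linear (\<lambda>x. x - L i x)"
    by (intro bounded_linear_sub bounded_linear_ident bounded_linear_L)
  from onorm[OF this, of x] show ?thesis
    using mult_right_mono[OF compl, of "norm x" i] by simp
qed

text \<open>
This is what shrinking means for the complements: each functional tends to 0 on the tails
\<open>z - L i z\<close>, uniformly over the unit ball.
\<close>

lemma dual_complement_tendsto:
  assumes f: "f \<in> dual scl" and e: "e > 0"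
  shows "\<forall>\<^sub>F i in F. \<forall>z\<in>cball 0 1. norm (f (z - L i z)) < e"
proof -
  have "((\<lambda>i. dual_norm UNIV norm ((f \<circ> L i) - f)) \<longlongrightarrow> 0) F"
    using approx f unfolding shrinking_metric_compact_approx_def dual_def by blast
  then have "\<forall>\<^sub>F i in F. dual_norm UNIV norm ((f \<circ> L i) - f) < e"
    using e by (rule order_tendstoD)
  then show ?thesis
  proof (eventually_elim, intro ballI)
    fix i z assume small: "dual_norm UNIV norm ((f \<circ> L i) - f) < e" and z: "z \<in> cball (0::'b) 1"
    have eq: "norm (((f \<circ> L i) - f) x) = norm (f (x - L i x))" for x
      by (simp add: dual_diff[OF f] norm_minus_commute)
    obtain C where "C > 0" and C: "\<And>x. norm (f x) \<le> C * norm x"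
      using dual_bounded[OF f] by blast
    have "norm (f (x - L i x)) \<le> C" if "norm x \<le> 1" for x
    proof -
      have "C * norm (x - L i x) \<le> C * 1"
        using norm_compl[of x i] that \<open>C > 0\<close> by (intro mult_left_mono) auto
      with C[of "x - L i x"] show ?thesis by simp
    qed
    then have "norm (f (z - L i z)) \<le> dual_norm UNIV norm ((f \<circ> L i) - f)"
      unfolding dual_norm_def eq using z by (intro cSUP_upper bdd_aboveI2[of _ _ C]) auto
    with small show "norm (f (z - L i z)) < e" by simp
  qed
qed

text \<open>
For large \<open>i\<close> the finitely many coordinates modulo \<open>H\<close> are uniformly small on the tails, so a
tail is a vector of \<open>H\<close> up to a small error, and the smoothness estimate for \<open>H\<close> applies to it.
\<close>

lemma smooth_tail_unit:
  assumes y: "norm y = 1" and t: "t > 0" "smooth_modulus scl t < s" and e: "e > 0"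
  shows "\<forall>\<^sub>F i in F. \<forall>z\<in>cball 0 1. norm (y + t *\<^sub>R (z - L i z)) \<le> 1 + s + e"
proof -
  obtain H B where H: "subspace H" "closed H" "finite B" "span (H \<union> B) = UNIV"
    and yH: "\<And>h. h \<in> H \<Longrightarrow> norm h < t \<Longrightarrow> norm (y + h) \<le> 1 + s"
    using smooth_closed_subspace[OF y t] by blast
  obtain \<phi> where \<phi>: "\<forall>b\<in>B. \<phi> b \<in> dual scl" "\<forall>z. z - (\<Sum>b\<in>B. scl (\<phi> b z) b) \<in> H"
    using closed_finite_codim_coordinates[OF H(3,1,2,4)] by blast
  define M where "M = 1 + (\<Sum>b\<in>B. norm b)"
  have M: "M > 0" by (simp add: M_def add_pos_nonneg sum_nonneg)
  define d where "d = e / 2"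
  have d: "d > 0" using e by (simp add: d_def)
  have "\<forall>\<^sub>F i in F. \<forall>z\<in>cball 0 1. norm (\<phi> b (z - L i z)) < d / (t * M)" if "b \<in> B" for b
    using \<phi>(1) that d t M by (intro dual_complement_tendsto) auto
  then have "\<forall>\<^sub>F i in F. \<forall>b\<in>B. \<forall>z\<in>cball 0 1. norm (\<phi> b (z - L i z)) < d / (t * M)"
    using H(3) by (intro eventually_ball_finite) auto
  then show ?thesis
  proof (eventually_elim, intro ballI)
    fix i z
    assume small: "\<forall>b\<in>B. \<forall>z\<in>cball 0 1. norm (\<phi> b (z - L i z)) < d / (t * M)" and z: "z \<in> cball (0::'b) 1"
    define w where "w = t *\<^sub>R (z - L i z)"
    define r where "r = (\<Sum>b\<in>B. scl (\<phi> b w) b)"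
    have w: "norm w \<le> t"
      using norm_compl[of z i] z t(1) by (simp add: w_def)
    have "norm r \<le> (\<Sum>b\<in>B. (d / M) * norm b)"
      unfolding r_def
    proof (rule sum_norm_le)
      fix b assume b: "b \<in> B"
      have "\<phi> b w = of_real t * \<phi> b (z - L i z)"
        using \<phi>(1) b unfolding dual_iff w_def scale_of_real[symmetric] by blast
      then have "norm (\<phi> b w) = t * norm (\<phi> b (z - L i z))" using t by (simp add: norm_mult)
      also have "\<dots> \<le> t * (d / (t * M))"
        using small b z t(1) by (intro mult_left_mono less_imp_le) auto
      also have "\<dots> = d / M" using t(1) by simp
      finally show "norm (scl (\<phi> b w) b) \<le> (d / M) * norm b"
        using mult_right_mono[of "norm (\<phi> b w)" "d / M" "norm b"] by (simp only: norm_scale norm_ge_zero)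
    qed
    also have "\<dots> = (d / M) * (M - 1)" unfolding sum_distrib_left[symmetric] by (simp add: M_def)
    also have "\<dots> < (d / M) * M" using d M by (intro mult_strict_left_mono) auto
    also have "\<dots> = d" using M by simp
    finally have r: "norm r < d" .
    \<comment> \<open>\<open>w - r\<close> lies in \<open>H\<close> but its norm may exceed \<open>t\<close> by less than \<open>d\<close>; shrinking it by \<open>l\<close> restores the bound\<close>
    define l where "l = t / (t + d)"
    have l: "0 < l" "l < 1" using t(1) d by (auto simp: l_def field_simps)
    have "l *\<^sub>R (w - r) \<in> H"
      using subspace_scale[OF H(1), of "w - r" "of_real l"] \<phi>(2) by (simp add: scale_of_real r_def)
    moreover have "norm (l *\<^sub>R (w - r)) < t"
    proof -
      have "norm (w - r) < t + d" using norm_triangle_ineq4[of w r] w r by linarith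
      then have "l * norm (w - r) < l * (t + d)" using l by simp
      also have "\<dots> = t" using t(1) d by (simp add: l_def)
      finally show ?thesis using l by simp
    qed
    ultimately have main: "norm (y + l *\<^sub>R (w - r)) \<le> 1 + s" by (rule yH)
    have "(1 - l) * norm w \<le> (1 - l) * t" using w l by (intro mult_left_mono) auto
    also have "\<dots> = l * d" using t(1) d by (simp add: l_def field_simps)
    also have "\<dots> \<le> d" using l d by (simp add: mult_left_le_one_le)
    finally have a: "norm ((1 - l) *\<^sub>R w) \<le> d" using l by simp
    have b: "norm (l *\<^sub>R r) \<le> d" using l r mult_left_le_one_le[of "norm r" l] by simp
    have "y + w = (y + l *\<^sub>R (w - r)) + ((1 - l) *\<^sub>R w + l *\<^sub>R r)"
      by (simp add: algebra_simps)
    then have "norm (y + w) \<le> norm (y + l *\<^sub>R (w - r)) + (norm ((1 - l) *\<^sub>R w) + norm (l *\<^sub>R r))"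
      by (metis norm_triangle_le add_left_mono norm_triangle_ineq)
    also have "\<dots> \<le> 1 + s + e" using main a b by (simp add: d_def)
    finally show "norm (y + t *\<^sub>R (z - L i z)) \<le> 1 + s + e" by (simp add: w_def)
  qed
qed

text \<open>
A vector of the unit ball is a convex combination of a unit vector \<open>u\<close> and \<open>- u\<close>. For the zero
vector any unit vector serves as \<open>u\<close>, and infinite dimension guarantees that there is one.
\<close>

lemma smooth_tail_ball:
  assumes y: "norm y \<le> 1" and t: "t > 0" "smooth_modulus scl t < s" and e: "e > 0"
  shows "\<forall>\<^sub>F i in F. \<forall>z\<in>cball 0 1. norm (y + t *\<^sub>R (z - L i z)) \<le> 1 + s + e"
proof -
  obtain u where u: "norm u = 1" "y = norm y *\<^sub>R u"
  proof (cases "y = 0")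
    case True
    have "span {} \<noteq> UNIV"
      using infinite_dim unfolding infinite_dimensional_def by blast
    then obtain x :: 'b where "x \<noteq> 0" by auto
    then show ?thesis using that[of "(1 / norm x) *\<^sub>R x"] True by simp
  next
    case False
    then show ?thesis using that[of "(1 / norm y) *\<^sub>R y"] by simp
  qed
  have "\<forall>\<^sub>F i in F. \<forall>z\<in>cball 0 1. norm (u + t *\<^sub>R (z - L i z)) \<le> 1 + s + e"
    using u(1) t e by (rule smooth_tail_unit)
  moreover have "\<forall>\<^sub>F i in F. \<forall>z\<in>cball 0 1. norm (- u + t *\<^sub>R (z - L i z)) \<le> 1 + s + e"
    using u(1) t e by (intro smooth_tail_unit) auto
  ultimately show ?thesis
  proof (eventually_elim, intro ballI)
    fix i z
    assume p: "\<forall>z\<in>cball 0 1. norm (u + t *\<^sub>R (z - L i z)) \<le> 1 + s + e"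
      and m: "\<forall>z\<in>cball 0 1. norm (- u + t *\<^sub>R (z - L i z)) \<le> 1 + s + e" and z: "z \<in> cball (0::'b) 1"
    define w where "w = t *\<^sub>R (z - L i z)"
    define a where "a = (1 + norm y) / 2"
    have a: "0 \<le> a" "a \<le> 1" using y by (auto simp: a_def)
    have "y + w = a *\<^sub>R (u + w) + (1 - a) *\<^sub>R (- u + w)"
    proof -
      have "a *\<^sub>R (u + w) + (1 - a) *\<^sub>R (- u + w) = (2 * a - 1) *\<^sub>R u + w"
        by (simp add: algebra_simps scaleR_2 flip: scaleR_scaleR)
      also have "2 * a - 1 = norm y" unfolding a_def by argo
      finally show ?thesis using u(2) by simp
    qed
    then have "norm (y + w) \<le> a * norm (u + w) + (1 - a) * norm (- u + w)"
      using a norm_triangle_ineq[of "a *\<^sub>R (u + w)" "(1 - a) *\<^sub>R (- u + w)"] by simp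
    also have "\<dots> \<le> a * (1 + s + e) + (1 - a) * (1 + s + e)"
      using p m z a unfolding w_def by (intro add_mono mult_left_mono) auto
    also have "\<dots> = 1 + s + e" by (simp add: algebra_simps)
    finally show "norm (y + t *\<^sub>R (z - L i z)) \<le> 1 + s + e" by (simp add: w_def)
  qed
qed

text \<open>
The form in which smoothness is used: uniformly over a compact set of vectors \<open>y\<close>, by means of a
finite net. The room between the modulus and \<open>s\<close> absorbs both errors.
\<close>

lemma smooth_tail_compact:
  assumes K: "compact K" "K \<subseteq> cball 0 1" and t: "t > 0" "smooth_modulus scl t < s"
  shows "\<forall>\<^sub>F i in F. \<forall>y\<in>K. \<forall>z\<in>cball 0 1. norm (y + t *\<^sub>R (z - L i z)) \<le> 1 + s"
proof -
  obtain s' where s': "smooth_modulus scl t < s'" "s' < s" using t(2) dense by blast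
  define e where "e = (s - s') / 2"
  have e: "e > 0" "s' + e + e = s" using s' by (auto simp: e_def)
  obtain k where k: "finite k" "k \<subseteq> K" "K \<subseteq> (\<Union>x\<in>k. ball x e)"
    using compactE_image[OF K(1), of K "\<lambda>x. ball x e"] e(1)
    by (metis UN_I centre_in_ball open_ball subsetI)
  have "\<forall>\<^sub>F i in F. \<forall>x\<in>k. \<forall>z\<in>cball 0 1. norm (x + t *\<^sub>R (z - L i z)) \<le> 1 + s' + e"
    using k K(2) t(1) s'(1) e(1) by (intro eventually_ball_finite ballI smooth_tail_ball) auto
  then show ?thesis
  proof (eventually_elim, intro ballI)
    fix i y z
    assume b: "\<forall>x\<in>k. \<forall>z\<in>cball 0 1. norm (x + t *\<^sub>R (z - L i z)) \<le> 1 + s' + e"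
      and y: "y \<in> K" and z: "z \<in> cball (0::'b) 1"
    obtain x where x: "x \<in> k" "norm (y - x) < e"
      using k(3) y by (auto simp: dist_norm norm_minus_commute)
    have "norm (y + t *\<^sub>R (z - L i z)) \<le> norm (y - x) + norm (x + t *\<^sub>R (z - L i z))"
      using norm_triangle_ineq[of "y - x" "x + t *\<^sub>R (z - L i z)"] by simp
    also have "\<dots> \<le> 1 + s" using b x z e by fastforce
    finally show "norm (y + t *\<^sub>R (z - L i z)) \<le> 1 + s" .
  qed
qed

end

section \<open>Spaces of homogeneous polynomials\<close>

lemma multilinear_slot_add:
  assumes "multilinear scaleE scaleF n A" "Suc (length ys + length zs) = n"
  shows "A (ys @ (u + v) # zs) = A (ys @ u # zs) + A (ys @ v # zs)"
proof -
  have "Vector_Spaces.linear scaleE scaleF (\<lambda>x. A ((ys @ u # zs)[length ys := x]))"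
    using assms unfolding multilinear_def
    by (metis length_append length_Cons add_Suc_right less_add_Suc1)
  then show ?thesis by (simp add: Vector_Spaces.linear_iff)
qed

lemma multilinear_slot_scale:
  assumes "multilinear scaleE scaleF n A" "Suc (length ys + length zs) = n"
  shows "A (ys @ scaleE c u # zs) = scaleF c (A (ys @ u # zs))"
proof -
  have "Vector_Spaces.linear scaleE scaleF (\<lambda>x. A ((ys @ u # zs)[length ys := x]))"
    using assms unfolding multilinear_def
    by (metis length_append length_Cons add_Suc_right less_add_Suc1)
  then show ?thesis by (simp add: Vector_Spaces.linear_iff)
qed

lemma poly_space_difference_degree:
  assumes "P \<in> poly_space scaleE scaleF n"
  shows "difference_degree n P"
proof -
  obtain A where A: "multilinear scaleE scaleF n A" and P: "P = (\<lambda>x. A (replicate n x))"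
    using assms unfolding poly_space_def by blast
  show ?thesis
    unfolding P by (rule difference_degree_diagonal) (rule multilinear_slot_add[OF A])
qed

lemma poly_space_homogeneous:
  assumes P: "P \<in> poly_space scaleE scaleF n" and F: "vector_space scaleF"
  shows "P (scaleE c x) = scaleF (c ^ n) (P x)"
proof -
  obtain A where A: "multilinear scaleE scaleF n A" and P: "P = (\<lambda>x. A (replicate n x))"
    using P unfolding poly_space_def by blast
  interpret F: vector_space scaleF by (rule F)
  have "A (replicate k (scaleE c x) @ replicate (n - k) x) = scaleF (c ^ k) (A (replicate n x))"
    if "k \<le> n" for k
    using that
  proof (induction k)
    case (Suc k)
    then have n: "replicate (n - k) x = x # replicate (n - Suc k) x"
      by (metis Suc_diff_Suc Suc_le_eq replicate_Suc)
    have "A (replicate (Suc k) (scaleE c x) @ replicate (n - Suc k) x) =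
        A (replicate k (scaleE c x) @ scaleE c x # replicate (n - Suc k) x)"
      by (simp add: replicate_append_same[symmetric] del: replicate_append_same)
    also have "\<dots> = scaleF c (A (replicate k (scaleE c x) @ replicate (n - k) x))"
      unfolding n using Suc.prems by (intro multilinear_slot_scale[OF A]) simp
    finally show ?case using Suc by simp
  qed simp
  from this[of n] show ?thesis by (simp add: P)
qed

lemma poly_space_linear_comp:
  assumes P: "P \<in> poly_space scaleE scaleF n" and T: "continuous_on UNIV T"
    and lin: "Vector_Spaces.linear scaleF scaleG T"
  shows "(\<lambda>x. T (P x)) \<in> poly_space scaleE scaleG n"
proof -
  obtain A where A: "multilinear scaleE scaleF n A" and PA: "\<And>x. P x = A (replicate n x)"
    and cont: "continuous_on UNIV P"
    using P unfolding poly_space_def by blast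
  have "multilinear scaleE scaleG n (\<lambda>xs. T (A xs))"
    using A lin unfolding multilinear_def Vector_Spaces.linear_iff by simp
  moreover have "continuous_on UNIV (\<lambda>x. T (P x))"
    by (rule continuous_on_compose2[OF T cont]) simp
  ultimately show ?thesis
    unfolding poly_space_def using PA by auto
qed

lemma norm_add_diff_le: "norm (a + b - c) \<le> norm a + norm b + norm c"
  using norm_triangle_ineq4[of "a + b" c] norm_triangle_ineq[of a b] by linarith

locale banach_pair = E: banach_over scaleE + F: banach_over scaleF
  for scaleE :: "'k::real_or_complex \<Rightarrow> 'e::banach \<Rightarrow> 'e"
    and scaleF :: "'k \<Rightarrow> 'f::banach \<Rightarrow> 'f" +
  fixes n :: nat
  assumes n: "n \<ge> 1"
begin

abbreviation X where "X \<equiv> poly_space scaleE scaleF n"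
abbreviation J where "J \<equiv> weak_poly_space scaleE scaleF n"
abbreviation scaleX where "scaleX \<equiv> (fun_scale scaleF :: 'k \<Rightarrow> ('e \<Rightarrow> 'f) \<Rightarrow> ('e \<Rightarrow> 'f))"

lemma module_scaleX: "module scaleX"
  by unfold_locales
    (auto simp: fun_scale_def fun_eq_iff F.scale_right_distrib F.scale_left_distrib)

lemma poly_add: "P \<in> X \<Longrightarrow> Q \<in> X \<Longrightarrow> P + Q \<in> X"
proof -
  assume "P \<in> X" "Q \<in> X"
  then obtain A C where A: "multilinear scaleE scaleF n A" "\<And>x. P x = A (replicate n x)"
    and C: "multilinear scaleE scaleF n C" "\<And>x. Q x = C (replicate n x)"
    and cont: "continuous_on UNIV P" "continuous_on UNIV Q"
    unfolding poly_space_def by blast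
  have "multilinear scaleE scaleF n (\<lambda>xs. A xs + C xs)"
    using A(1) C(1) unfolding multilinear_def Vector_Spaces.linear_iff
    by (simp add: F.scale_right_distrib algebra_simps)
  moreover have "continuous_on UNIV (\<lambda>x. P x + Q x)"
    using cont by (rule continuous_on_add)
  ultimately show ?thesis
    unfolding poly_space_def plus_fun_def using A(2) C(2) by auto
qed

lemma linear_scale: "Vector_Spaces.linear scaleF scaleF (scaleF c)"
  by (simp add: Vector_Spaces.linear_iff F.vector_space_axioms F.scale_right_distrib mult.commute)

lemma poly_scale: "P \<in> X \<Longrightarrow> scaleX c P \<in> X"
  unfolding fun_scale_def by (rule poly_space_linear_comp[OF _ F.continuous_scale linear_scale])

lemma poly_zero: "0 \<in> X"
proof -
  have "Vector_Spaces.linear scaleE scaleF (\<lambda>x. 0)"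
    by (simp add: Vector_Spaces.linear_iff E.vector_space_axioms F.vector_space_axioms)
  then have "multilinear scaleE scaleF n (\<lambda>xs. 0)" by (simp add: multilinear_def)
  then show ?thesis unfolding poly_space_def zero_fun_def by auto
qed

lemma poly_diff: "P \<in> X \<Longrightarrow> Q \<in> X \<Longrightarrow> P - Q \<in> X"
proof -
  assume "P \<in> X" "Q \<in> X"
  then have "P + scaleX (- 1) Q \<in> X" by (intro poly_add poly_scale)
  also have "P + scaleX (- 1) Q = P - Q" by (simp add: fun_scale_def fun_eq_iff)
  finally show ?thesis .
qed

lemma poly_homogeneous:
  assumes P: "P \<in> X"
  shows "P (r *\<^sub>R x) = (r ^ n) *\<^sub>R P x"
  using poly_space_homogeneous[OF P F.vector_space_axioms, of "of_real r" x]
  by (simp add: E.scale_of_real F.scale_of_real flip: of_real_power)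

lemma poly_bounded_on_ball:
  assumes P: "P \<in> X"
  shows "bdd_above ((\<lambda>x. norm (P x)) ` cball 0 1)"
proof -
  have "P 0 = 0"
    using poly_homogeneous[OF P, of 0 0] n by (simp add: power_0_left)
  moreover have "isCont P 0"
    using P unfolding poly_space_def by (simp add: continuous_on_eq_continuous_at)
  ultimately obtain d where d: "d > 0" "\<And>x. norm x < d \<Longrightarrow> norm (P x) < 1"
    unfolding continuous_at_eps_delta by (force simp: dist_norm dest: spec[of _ 1])
  have "norm (P x) \<le> (2 / d) ^ n" if "x \<in> cball 0 1" for x
  proof -
    have "norm (P ((d / 2) *\<^sub>R x)) < 1"
      using that d(1) mult_left_mono[of "norm x" 1 "d / 2"] by (intro d(2)) auto
    then have "(d / 2) ^ n * norm (P x) \<le> 1"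
      using d(1) by (simp add: poly_homogeneous[OF P])
    then show ?thesis using d(1) by (simp add: field_simps power_divide)
  qed
  then show ?thesis by (rule bdd_aboveI2)
qed

lemma norm_le_poly_norm: "P \<in> X \<Longrightarrow> norm x \<le> 1 \<Longrightarrow> norm (P x) \<le> poly_norm P"
  unfolding poly_norm_def by (rule cSUP_upper) (auto intro: poly_bounded_on_ball)

lemma poly_norm_le: "(\<And>x. norm x \<le> 1 \<Longrightarrow> norm (P x) \<le> C) \<Longrightarrow> poly_norm P \<le> C"
  unfolding poly_norm_def by (rule cSUP_least) auto

lemma poly_norm_nonneg: "P \<in> X \<Longrightarrow> 0 \<le> poly_norm P"
  using order_trans[OF norm_ge_zero norm_le_poly_norm[of P 0]] by simp

lemma norm_poly_le:
  assumes P: "P \<in> X"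
  shows "norm (P x) \<le> poly_norm P * norm x ^ n"
proof (cases "x = 0")
  case True
  then show ?thesis using poly_homogeneous[OF P, of 0 0] n by (simp add: power_0_left)
next
  case False
  then have "norm (P ((1 / norm x) *\<^sub>R x)) \<le> poly_norm P"
    by (intro norm_le_poly_norm P) simp
  then show ?thesis using False by (simp add: poly_homogeneous[OF P] field_simps power_divide)
qed

lemma poly_norm_scale:
  assumes P: "P \<in> X"
  shows "poly_norm (scaleX c P) = norm c * poly_norm P"
proof -
  have "poly_norm (scaleX c P) = (SUP x\<in>cball 0 1. norm c * norm (P x))"
    by (simp add: poly_norm_def fun_scale_def F.norm_scale)
  also have "\<dots> = norm c * poly_norm P"
  proof (rule antisym)
    show "(SUP x\<in>cball 0 1. norm c * norm (P x)) \<le> norm c * poly_norm P"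
      by (rule cSUP_least) (auto intro!: mult_left_mono norm_le_poly_norm[OF P])
    show "norm c * poly_norm P \<le> (SUP x\<in>cball 0 1. norm c * norm (P x))"
    proof (cases "c = 0")
      case False
      have "poly_norm P \<le> (SUP x\<in>cball 0 1. norm c * norm (P x)) / norm c"
      proof (rule poly_norm_le)
        fix x :: 'e assume x: "norm x \<le> 1"
        have "bdd_above ((\<lambda>x. norm c * norm (P x)) ` cball 0 1)"
          by (rule bdd_aboveI2[of _ _ "norm c * poly_norm P"])
            (auto intro!: mult_left_mono norm_le_poly_norm[OF P])
        then have "norm c * norm (P x) \<le> (SUP x\<in>cball 0 1. norm c * norm (P x))"
          using x by (intro cSUP_upper) auto
        then show "norm (P x) \<le> (SUP x\<in>cball 0 1. norm c * norm (P x)) / norm c"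
          using False by (simp add: field_simps)
      qed
      then show ?thesis using False by (simp add: field_simps)
    qed simp
  qed
  finally show ?thesis .
qed

lemma weak_subset: "J \<subseteq> X"
  by (auto simp: weak_poly_space_def)

lemma weak_subspace: "module.subspace scaleX J"
  unfolding module.subspace_def[OF module_scaleX]
proof (intro conjI ballI allI)
  show "0 \<in> J"
    using poly_zero by (simp add: weak_poly_space_def weakly_cont_on_bounded_def zero_fun_def)
next
  fix P Q assume "P \<in> J" "Q \<in> J"
  moreover from this have "P + Q \<in> X" using weak_subset by (intro poly_add) auto
  ultimately show "P + Q \<in> J"
    unfolding weak_poly_space_def weakly_cont_on_bounded_def
    by (auto intro!: tendsto_add simp: plus_fun_def)
next
  fix c P assume P: "P \<in> J"
  have "weakly_cont_on_bounded scaleE (scaleX c P)"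
    unfolding weakly_cont_on_bounded_def fun_scale_def
  proof (intro allI impI)
    fix G B a assume "bounded B" "eventually (\<lambda>x. x \<in> B) G" "weakly_converges scaleE G a"
    then have "(P \<longlongrightarrow> P a) G"
      using P unfolding weak_poly_space_def weakly_cont_on_bounded_def by blast
    then show "((\<lambda>x. scaleF c (P x)) \<longlongrightarrow> scaleF c (P a)) G"
      by (intro continuous_on_tendsto_compose[OF F.continuous_scale[of UNIV]]) auto
  qed
  with P show "scaleX c P \<in> J"
    by (simp add: weak_poly_space_def poly_scale)
qed

lemma weak_closed:
  assumes P: "P \<in> X" and approx: "\<And>e. e > 0 \<Longrightarrow> \<exists>Q\<in>J. poly_norm (P - Q) < e"
  shows "P \<in> J"
proof -
  have "weakly_cont_on_bounded scaleE P"
    unfolding weakly_cont_on_bounded_def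
  proof (intro allI impI)
    fix G B a assume B: "bounded B" "eventually (\<lambda>x. x \<in> B) G" and w: "weakly_converges scaleE G a"
    obtain R where R: "R > 0" "\<forall>x\<in>insert a B. norm x \<le> R"
      using B(1) bounded_insert bounded_pos by metis
    show "(P \<longlongrightarrow> P a) G"
    proof (rule tendstoI)
      fix e :: real assume e: "e > 0"
      then obtain Q where Q: "Q \<in> J" "poly_norm (P - Q) < e / (3 * R ^ n)"
        using approx[of "e / (3 * R ^ n)"] R(1) by auto
      have PQ: "norm (P x - Q x) \<le> e / 3" if x: "norm x \<le> R" for x
      proof -
        have PQX: "P - Q \<in> X" using P Q weak_subset poly_diff by blast
        have "norm (P x - Q x) \<le> poly_norm (P - Q) * norm x ^ n"
          using norm_poly_le[OF PQX, of x] by simp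
        also have "\<dots> \<le> (e / (3 * R ^ n)) * R ^ n"
          using Q(2) x poly_norm_nonneg[OF PQX] e R(1)
          by (intro mult_mono power_mono) auto
        also have "\<dots> = e / 3" using R(1) by simp
        finally show ?thesis .
      qed
      have "(Q \<longlongrightarrow> Q a) G"
        using Q B w unfolding weak_poly_space_def weakly_cont_on_bounded_def by blast
      then have "\<forall>\<^sub>F x in G. dist (Q x) (Q a) < e / 3" using e by (intro tendstoD) auto
      with B(2) show "\<forall>\<^sub>F x in G. dist (P x) (P a) < e"
      proof eventually_elim
        case (elim x)
        have "norm (P x - Q x) \<le> e / 3" "norm (P a - Q a) \<le> e / 3"
          using PQ R elim by auto
        moreover have "P x - P a = (P x - Q x) + (Q x - Q a) - (P a - Q a)" by simp
        then have "norm (P x - P a) \<le> norm (P x - Q x) + norm (Q x - Q a) + norm (P a - Q a)"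
          by (simp only: norm_add_diff_le)
        ultimately show ?case using elim by (simp add: dist_norm)
      qed
    qed
  qed
  with P show ?thesis by (simp add: weak_poly_space_def)
qed

lemma weak_closed_subspace: "closed_subspace scaleX X poly_norm J"
  unfolding closed_subspace_def using weak_subset weak_subspace weak_closed by blast

text \<open>
Below the critical degree every scalar polynomial is weakly continuous on bounded sets, hence so
is \<open>P\<close> followed by \<open>T\<close> and any functional. On a bounded set the values \<open>T (P x)\<close> stay in a norm
compact set, where functionals that separate points determine norm convergence.
\<close>

lemma compact_operator_comp_weak:
  assumes cd: "enat n < critical_degree scaleE"
    and sep: "\<And>y. y \<noteq> 0 \<Longrightarrow> \<exists>f\<in>dual scaleF. f y \<noteq> 0"
    and T: "compact_operator scaleF T" and P: "P \<in> X"
  shows "(\<lambda>x. T (P x)) \<in> J"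
proof -
  have bl: "bounded_linear T" using T by (rule F.compact_operator_bounded_linear)
  have TP: "(\<lambda>x. T (P x)) \<in> X"
    by (rule poly_space_linear_comp[OF P linear_continuous_on[OF bl]])
      (use T in \<open>simp add: compact_operator_def\<close>)
  have scalar: "weakly_cont_on_bounded scaleE Q" if "Q \<in> poly_space scaleE (*) n" for Q :: "'e \<Rightarrow> 'k"
  proof (rule ccontr)
    assume "\<not> weakly_cont_on_bounded scaleE Q"
    then have "weak_poly_space scaleE (*) n \<noteq> poly_space scaleE ((*) :: 'k \<Rightarrow> 'k \<Rightarrow> 'k) n"
      using that by (auto simp: weak_poly_space_def)
    then have "critical_degree scaleE \<le> enat n"
      unfolding critical_degree_def using n by (intro INF_lower) simp
    with cd show False by simp
  qed
  have "weakly_cont_on_bounded scaleE (\<lambda>x. T (P x))"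
    unfolding weakly_cont_on_bounded_def
  proof (intro allI impI)
    fix G B a assume B: "bounded B" "eventually (\<lambda>x. x \<in> B) G" and w: "weakly_converges scaleE G a"
    obtain R where R: "R > 0" "\<forall>x\<in>B. norm x \<le> R"
      using B(1) bounded_pos by metis
    let ?S = "(\<lambda>y. R ^ n *\<^sub>R y) ` ((\<lambda>y. (poly_norm P + 1) *\<^sub>R y) ` closure (T ` cball 0 1))"
    show "((\<lambda>x. T (P x)) \<longlongrightarrow> T (P a)) G"
    proof (rule tendsto_of_separating_functions[where S = ?S and D = "dual scaleF"])
      show "compact ?S"
        using T unfolding compact_operator_def by (intro compact_scaling) simp
      have "T (P x) \<in> ?S" if "x \<in> B" for x
      proof -
        have p: "poly_norm P + 1 > 0" using poly_norm_nonneg[OF P] by simp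
        define u where "u = (1 / (R ^ n * (poly_norm P + 1))) *\<^sub>R P x"
        have "norm (P x) \<le> poly_norm P * norm x ^ n" by (rule norm_poly_le[OF P])
        also have "\<dots> \<le> (poly_norm P + 1) * R ^ n"
          using R that poly_norm_nonneg[OF P] by (intro mult_mono power_mono) auto
        finally have "norm (P x) \<le> R ^ n * (poly_norm P + 1)" by (simp only: mult.commute)
        then have "norm u \<le> 1" using R p by (simp add: u_def abs_mult)
        then have "T u \<in> closure (T ` cball 0 1)" by (intro subsetD[OF closure_subset] imageI) simp
        moreover have "T (P x) = R ^ n *\<^sub>R ((poly_norm P + 1) *\<^sub>R T u)"
          using R p by (simp add: u_def linear_simps(5)[OF bl])
        ultimately show ?thesis by blast
      qed
      with B(2) show "\<forall>\<^sub>F x in G. T (P x) \<in> ?S" by (auto elim: eventually_mono)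
    next
      fix f assume f: "f \<in> dual scaleF"
      show "continuous_on UNIV f" using f by (rule dual_continuous)
      have "Vector_Spaces.linear scaleF (*) f"
        using f by (simp add: Vector_Spaces.linear_iff dual_iff F.vector_space_axioms
            vector_space_over_itself.vector_space_axioms)
      from poly_space_linear_comp[OF TP dual_continuous[OF f] this] scalar
      have "weakly_cont_on_bounded scaleE (\<lambda>x. f (T (P x)))" by blast
      then show "((\<lambda>x. f (T (P x))) \<longlongrightarrow> f (T (P a))) G"
        using B w unfolding weakly_cont_on_bounded_def by blast
    next
      fix y assume "y \<noteq> T (P a)"
      then obtain f where "f \<in> dual scaleF" "f (y - T (P a)) \<noteq> 0" using sep[of "y - T (P a)"] by auto
      then show "\<exists>f\<in>dual scaleF. f y \<noteq> f (T (P a))"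
        by (intro bexI[of _ f]) (auto simp: dual_diff)
    qed
  qed
  with TP show ?thesis by (simp add: weak_poly_space_def)
qed

text \<open>
Contractions that converge pointwise converge uniformly on totally bounded sets, and \<open>P\<close> maps the
unit ball to such a set.
\<close>

lemma weak_approximation:
  assumes P: "P \<in> J" and bl: "\<And>i. bounded_linear (L i)" and contr: "\<And>i y. norm (L i y) \<le> norm y"
    and lim: "\<And>y. ((\<lambda>i. L i y) \<longlongrightarrow> y) G" and e: "e > 0"
  shows "\<forall>\<^sub>F i in G. poly_norm ((\<lambda>x. L i (P x)) - P) \<le> e"
proof -
  have "((\<lambda>(x, y). P x - P y) \<longlongrightarrow> 0) (cover_filter (cball 0 1))"
    by (rule weakly_uniformly_continuous_on_bounded[of n _ scaleE])
      (use P poly_space_difference_degree in \<open>auto simp: weak_poly_space_def\<close>)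
  then have "\<forall>\<^sub>F (x, y) in cover_filter (cball 0 1). norm (P x - P y) < e / 3"
    using tendstoD[of _ 0 _ "e / 3"] e by (fastforce simp: case_prod_unfold)
  then obtain C where C: "finite C" "cball 0 1 \<subseteq> \<Union>C"
    and small: "\<And>V x y. V \<in> C \<Longrightarrow> x \<in> V \<Longrightarrow> y \<in> V \<Longrightarrow> norm (P x - P y) < e / 3"
    unfolding eventually_cover_filter by force
  define a where "a = (\<lambda>V :: 'e set. SOME x. x \<in> V)"
  have a: "a V \<in> V" if "x \<in> V" for x V
    unfolding a_def using that by (rule someI)
  have "\<forall>\<^sub>F i in G. dist (L i (P (a V))) (P (a V)) < e / 3" for V
    using lim e by (intro tendstoD) auto
  then have "\<forall>\<^sub>F i in G. \<forall>V\<in>C. dist (L i (P (a V))) (P (a V)) < e / 3"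
    using C(1) by (intro eventually_ball_finite) auto
  then show ?thesis
  proof eventually_elim
    case (elim i)
    show ?case
    proof (rule poly_norm_le)
      fix x :: 'e assume "norm x \<le> 1"
      then obtain V where V: "V \<in> C" "x \<in> V" using C(2) by auto
      have 1: "norm (P x - P (a V)) < e / 3" using small V a by blast
      have 2: "norm (L i (P x - P (a V))) < e / 3" using contr[of i "P x - P (a V)"] 1 by linarith
      have 3: "norm (L i (P (a V)) - P (a V)) < e / 3" using elim V by (simp add: dist_norm)
      have "L i (P x) - P x = L i (P x - P (a V)) + (L i (P (a V)) - P (a V)) - (P x - P (a V))"
        by (simp add: linear_simps(2)[OF bl])
      then have "norm (L i (P x) - P x) \<le>
          norm (L i (P x - P (a V))) + norm (L i (P (a V)) - P (a V)) + norm (P x - P (a V))"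
        by (simp only: norm_add_diff_le)
      with 1 2 3 show "norm (((\<lambda>x. L i (P x)) - P) x) \<le> e" by simp
    qed
  qed
qed

end

section \<open>HB-subspaces from approximations with smooth tails\<close>

text \<open>
The argument on functionals uses of the polynomial spaces only the following: operators \<open>T i\<close> from
\<open>X\<close> to \<open>J\<close> that converge to the identity on \<open>J\<close>, are contractions together with their complements, and
satisfy a smoothness estimate. In the latter \<open>T i\<close> and \<open>x\<close> are chosen before the tail operator \<open>T j\<close>,
while \<open>t\<close> depends on \<open>\<kappa>\<close> only.
\<close>

locale approximated_subspace = module scl
  for scl :: "'k::real_or_complex \<Rightarrow> 'v::ab_group_add \<Rightarrow> 'v" +
  fixes X J :: "'v set" and N :: "'v \<Rightarrow> real" and T :: "'i \<Rightarrow> 'v \<Rightarrow> 'v" and F :: "'i filter"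
  assumes X: "subspace X" and N_nonneg: "x \<in> X \<Longrightarrow> 0 \<le> N x"
    and N_scale: "x \<in> X \<Longrightarrow> N (scl c x) = norm c * N x"
    and J: "closed_subspace scl X N J"
    and T_J: "x \<in> X \<Longrightarrow> T i x \<in> J"
    and T_add: "x \<in> X \<Longrightarrow> y \<in> X \<Longrightarrow> T i (x + y) = T i x + T i y"
    and T_scale: "x \<in> X \<Longrightarrow> T i (scl c x) = scl c (T i x)"
    and T_contraction: "x \<in> X \<Longrightarrow> N (T i x) \<le> N x"
    and T_complement: "x \<in> X \<Longrightarrow> N (x - T i x) \<le> N x"
    and F: "F \<noteq> bot"
    and T_tendsto: "x \<in> J \<Longrightarrow> ((\<lambda>i. N (T i x - x)) \<longlongrightarrow> 0) F"
    and smooth_tails: "\<kappa> > 0 \<Longrightarrow> \<exists>t>0. \<forall>x\<in>X. \<forall>y\<in>X. \<forall>i. N x \<le> 1 \<longrightarrow> N y \<le> 1 \<longrightarrow>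
        (\<forall>\<^sub>F j in F. N (T i x + scl (of_real t) (y - T j y)) \<le> 1 + \<kappa> * t)"
begin

abbreviation D where "D \<equiv> dual_space scl X N"

lemma J_subset: "x \<in> J \<Longrightarrow> x \<in> X"
  using J by (auto simp: closed_subspace_def)

lemma T_X: "x \<in> X \<Longrightarrow> T i x \<in> X"
  using T_J J_subset by blast

lemma D_add: "f \<in> D \<Longrightarrow> x \<in> X \<Longrightarrow> y \<in> X \<Longrightarrow> f (x + y) = f x + f y"
  and D_scale: "f \<in> D \<Longrightarrow> x \<in> X \<Longrightarrow> f (scl c x) = c * f x"
  and D_outside: "f \<in> D \<Longrightarrow> x \<notin> X \<Longrightarrow> f x = 0"
  by (simp_all add: dual_space_def)

lemma D_diff:
  assumes "f \<in> D" "x \<in> X" "y \<in> X"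
  shows "f (x - y) = f x - f y"
  using D_add[OF assms(1), of "x - y" y] subspace_diff[OF X] assms by simp

lemma D_bdd:
  assumes "f \<in> D"
  shows "bdd_above ((\<lambda>x. norm (f x)) ` {x \<in> X. N x \<le> 1})"
proof -
  obtain C where C: "\<And>x. x \<in> X \<Longrightarrow> norm (f x) \<le> C * N x"
    using assms unfolding dual_space_def by blast
  have "norm (f x) \<le> \<bar>C\<bar>" if "x \<in> X" "N x \<le> 1" for x
  proof -
    have "C * N x \<le> \<bar>C\<bar> * 1" using that N_nonneg by (intro mult_mono) auto
    with C[OF that(1)] show ?thesis by simp
  qed
  then show ?thesis by (intro bdd_aboveI2) auto
qed

lemma D_norm_ball: "f \<in> D \<Longrightarrow> x \<in> X \<Longrightarrow> N x \<le> 1 \<Longrightarrow> norm (f x) \<le> dual_norm X N f"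
  unfolding dual_norm_def by (rule cSUP_upper[OF _ D_bdd]) auto

lemma D_norm:
  assumes f: "f \<in> D" and x: "x \<in> X" and a: "a > 0" "N x \<le> a"
  shows "norm (f x) \<le> dual_norm X N f * a"
proof -
  define r where "r = 1 / a"
  have r: "r > 0" "r * a = 1" using a(1) by (auto simp: r_def)
  have "r * N x \<le> r * a" using a(2) r(1) by (intro mult_left_mono) auto
  then have "N (scl (of_real r) x) \<le> 1"
    unfolding N_scale[OF x] using r by simp
  from D_norm_ball[OF f subspace_scale[OF X x] this]
  have "r * norm (f x) \<le> dual_norm X N f"
    using r(1) unfolding D_scale[OF f x] by (simp add: norm_mult)
  then show ?thesis using a(1) by (simp add: r_def field_simps)
qed

lemma dual_norm_le:
  "(\<And>x. x \<in> X \<Longrightarrow> N x \<le> 1 \<Longrightarrow> norm (f x) \<le> C) \<Longrightarrow> dual_norm X N f \<le> C"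
  unfolding dual_norm_def using subspace_0[OF X] N_scale[OF subspace_0[OF X], of 0]
  by (intro cSUP_least) auto

lemma dual_norm_nonneg:
  assumes "f \<in> D"
  shows "0 \<le> dual_norm X N f"
  using order_trans[OF norm_ge_zero D_norm_ball[OF assms subspace_0[OF X]]]
    N_scale[OF subspace_0[OF X], of 0] by simp

definition U where "U = (SOME U. U \<le> F \<and> ultrafilter U)"

lemma U: "U \<le> F" "ultrafilter U" "U \<noteq> bot"
proof -
  have "U \<le> F \<and> ultrafilter U"
    unfolding U_def by (rule someI_ex) (use ex_ultrafilter_le[OF F] in blast)
  then show "U \<le> F" "ultrafilter U" "U \<noteq> bot" by (auto simp: ultrafilter_def)
qed

text \<open>
The candidate for the projection is the limit of the functionals \<open>f\<close> composed with \<open>T i\<close>. It depends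
only on the restriction of \<open>f\<close> to \<open>J\<close> and is an extension of this restriction, since \<open>T i\<close> tends to
the identity there. This gives both that \<open>q\<close> is idempotent and that its kernel is the annihilator
of \<open>J\<close>. The value 0 outside \<open>X\<close> is the convention for functionals on a carrier.
\<close>

definition q where "q f x = (if x \<in> X then Lim U (\<lambda>i. f (T i x)) else (0::'k))"

lemma q_tendsto:
  assumes f: "f \<in> D" and x: "x \<in> X"
  shows "((\<lambda>i. f (T i x)) \<longlongrightarrow> q f x) U"
proof -
  let ?r = "dual_norm X N f * (N x + 1)"
  have "norm (f (T i x)) \<le> ?r" for i
    using N_nonneg[OF x] T_contraction[OF x, of i] by (intro D_norm f T_X x) auto
  then have "\<exists>l\<in>cball 0 ?r. ((\<lambda>i. f (T i x)) \<longlongrightarrow> l) U"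
    by (intro ultrafilter_tendsto_compact U compact_cball_scalars) auto
  then show ?thesis
    unfolding q_def using x tendsto_Lim[OF U(3)] by auto
qed

lemma q_eqI:
  "f \<in> D \<Longrightarrow> x \<in> X \<Longrightarrow> ((\<lambda>i. f (T i x)) \<longlongrightarrow> l) U \<Longrightarrow> q f x = l"
  using tendsto_unique[OF U(3) q_tendsto] by blast

lemma q_D:
  assumes f: "f \<in> D"
  shows "q f \<in> D"
proof -
  have add: "q f (x + y) = q f x + q f y" if "x \<in> X" "y \<in> X" for x y
  proof (rule q_eqI[OF f subspace_add[OF X that]])
    have "((\<lambda>i. f (T i x) + f (T i y)) \<longlongrightarrow> q f x + q f y) U"
      using that f by (intro tendsto_add q_tendsto)
    then show "((\<lambda>i. f (T i (x + y))) \<longlongrightarrow> q f x + q f y) U"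
      using that by (simp add: T_add D_add[OF f] T_X)
  qed
  have scale: "q f (scl c x) = c * q f x" if "x \<in> X" for c x
  proof (rule q_eqI[OF f subspace_scale[OF X that]])
    have "((\<lambda>i. c * f (T i x)) \<longlongrightarrow> c * q f x) U"
      using that f by (intro tendsto_mult_left q_tendsto)
    then show "((\<lambda>i. f (T i (scl c x))) \<longlongrightarrow> c * q f x) U"
      using that by (simp add: T_scale D_scale[OF f] T_X)
  qed
  obtain C where C: "\<And>x. x \<in> X \<Longrightarrow> norm (f x) \<le> C * N x"
    using f unfolding dual_space_def by blast
  have "norm (q f x) \<le> \<bar>C\<bar> * N x" if x: "x \<in> X" for x
  proof (rule tendsto_upperbound[OF tendsto_norm[OF q_tendsto[OF f x]] always_eventually U(3)], rule)
    fix i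
    have "norm (f (T i x)) \<le> C * N (T i x)" using C T_X x by blast
    also have "\<dots> \<le> \<bar>C\<bar> * N x"
      using T_contraction[OF x] N_nonneg[OF T_X[OF x]] by (intro mult_mono) auto
    finally show "norm (f (T i x)) \<le> \<bar>C\<bar> * N x" .
  qed
  moreover have "q f x = 0" if "x \<notin> X" for x using that by (simp add: q_def)
  ultimately show ?thesis
    unfolding dual_space_def using add scale by blast
qed

lemma q_add:
  assumes "f \<in> D" "g \<in> D"
  shows "q (f + g) = q f + q g"
proof
  fix x
  show "q (f + g) x = (q f + q g) x"
  proof (cases "x \<in> X")
    case True
    have "((\<lambda>i. (f + g) (T i x)) \<longlongrightarrow> q f x + q g x) U"
      unfolding plus_fun_apply using True assms by (intro tendsto_add q_tendsto)
    then show ?thesis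
      using True tendsto_Lim[OF U(3)] by (simp add: q_def)
  qed (simp add: q_def)
qed

lemma q_scale:
  assumes "f \<in> D"
  shows "q (\<lambda>x. c * f x) = (\<lambda>x. c * q f x)"
proof
  fix x
  show "q (\<lambda>x. c * f x) x = c * q f x"
  proof (cases "x \<in> X")
    case True
    have "((\<lambda>i. c * f (T i x)) \<longlongrightarrow> c * q f x) U"
      using True assms by (intro tendsto_mult_left q_tendsto)
    then show ?thesis
      using True tendsto_Lim[OF U(3)] by (simp add: q_def)
  qed (simp add: q_def)
qed

lemma q_J:
  assumes f: "f \<in> D" and x: "x \<in> J"
  shows "q f x = f x"
proof (rule q_eqI[OF f J_subset[OF x]])
  obtain C where C: "\<And>x. x \<in> X \<Longrightarrow> norm (f x) \<le> C * N x"
    using f unfolding dual_space_def by blast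
  have lim: "((\<lambda>i. C * N (T i x - x)) \<longlongrightarrow> C * 0) F"
    using T_tendsto[OF x] by (rule tendsto_mult_left)
  have "((\<lambda>i. f (T i x) - f x) \<longlongrightarrow> 0) F"
  proof (rule tendsto_norm_zero_cancel, rule tendsto_sandwich[OF _ _ tendsto_const])
    show "((\<lambda>i. C * N (T i x - x)) \<longlongrightarrow> 0) F" using lim by simp
    show "\<forall>\<^sub>F i in F. norm (f (T i x) - f x) \<le> C * N (T i x - x)"
      using C[OF subspace_diff[OF X T_X[OF J_subset[OF x]] J_subset[OF x]]]
      by (simp add: D_diff[OF f] T_X J_subset x)
  qed simp
  then have "((\<lambda>i. f (T i x)) \<longlongrightarrow> f x) F" by (simp add: LIM_zero_iff)
  then show "((\<lambda>i. f (T i x)) \<longlongrightarrow> f x) U" using U(1) by (rule tendsto_mono[rotated])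
qed

lemma q_cong: 
  assumes "\<And>x. x \<in> J \<Longrightarrow> f x = g x"
  shows "q f = q g"
  by (rule ext) (simp add: q_def assms T_J)

lemma q_idem: "f \<in> D \<Longrightarrow> q (q f) = q f"
  by (rule q_cong) (rule q_J)

lemma kernel_q: "{f \<in> D. q f = 0} = annihilator scl X N J"
proof -
  have "f y = 0" if "f \<in> D" "q f = 0" "y \<in> J" for f y
    using q_J[OF that(1,3)] that(2) by simp
  moreover have "q f = 0" if "\<forall>y\<in>J. f y = 0" for f
  proof
    fix x
    have "Lim U (\<lambda>i. f (T i x)) = 0" if "x \<in> X"
      using tendsto_Lim[OF U(3), of "\<lambda>i. f (T i x)" 0] \<open>\<forall>y\<in>J. f y = 0\<close> T_J[OF that] by simp
    then show "q f x = 0 x" by (simp add: q_def)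
  qed
  ultimately show ?thesis
    by (auto simp: annihilator_def)
qed

lemma complement_tendsto:
  assumes f: "f \<in> D" and x: "x \<in> X"
  shows "((\<lambda>i. f (x - T i x)) \<longlongrightarrow> (f - q f) x) U"
  using tendsto_diff[OF tendsto_const q_tendsto[OF f x], of "f x"]
  by (simp add: D_diff[OF f x T_X[OF x]])

lemma dual_norm_complement:
  assumes f: "f \<in> D"
  shows "dual_norm X N (f - q f) \<le> dual_norm X N f"
proof (rule dual_norm_le)
  fix x assume x: "x \<in> X" "N x \<le> 1"
  have "norm (f (x - T i x)) \<le> dual_norm X N f" for i
    by (rule D_norm_ball[OF f subspace_diff[OF X x(1) T_X[OF x(1)]]])
      (rule order_trans[OF T_complement[OF x(1)] x(2)])
  then show "norm ((f - q f) x) \<le> dual_norm X N f"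
    by (intro tendsto_upperbound[OF tendsto_norm[OF complement_tendsto[OF f x(1)]] always_eventually U(3)]) simp
qed

text \<open>
Let \<open>y\<close> be a vector of the unit ball at which \<open>f - q f\<close> has modulus \<open>\<eta> > 0\<close>. Adding to \<open>T i x\<close> the tail of
a rotated multiple \<open>t * y\<close> raises the norm to at most \<open>1 + \<kappa> * t\<close>, but raises the modulus of \<open>f\<close>, in the
limit, by \<open>t * \<eta>\<close>. Hence \<open>norm (f (T i x)) + t * \<eta>\<close> is at most \<open>M * (1 + \<kappa> * t)\<close> for all \<open>i\<close>, where \<open>M\<close> is the norm of
\<open>f\<close>. With \<open>\<kappa>\<close> small compared with \<open>\<eta>\<close> this is a gap of \<open>t * \<eta> / 2\<close>, uniform in \<open>x\<close>, below \<open>M\<close>.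
\<close>

lemma dual_norm_projection_strict:
  assumes f: "f \<in> D" and ne: "f \<noteq> q f"
  shows "dual_norm X N (q f) < dual_norm X N f"
proof -
  define M where "M = dual_norm X N f"
  have M: "0 \<le> M" unfolding M_def by (rule dual_norm_nonneg[OF f])
  obtain y where y: "y \<in> X" "N y \<le> 1" "(f - q f) y \<noteq> 0"
  proof -
    obtain z where z: "f z \<noteq> q f z" using ne by blast
    then have zX: "z \<in> X" using D_outside[OF f] D_outside[OF q_D[OF f]] by metis
    define r where "r = 1 / (N z + 1)"
    have r: "r > 0" "r * N z \<le> 1" using N_nonneg[OF zX] by (auto simp: r_def field_simps)
    have "N (scl (of_real r) z) \<le> 1"
      unfolding N_scale[OF zX] using r by simp
    moreover have "(f - q f) (scl (of_real r) z) = of_real r * (f z - q f z)"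
      by (simp add: D_scale[OF f zX] D_scale[OF q_D[OF f] zX] right_diff_distrib)
    then have "(f - q f) (scl (of_real r) z) \<noteq> 0" using z r by simp
    ultimately show ?thesis using that subspace_scale[OF X zX] by blast
  qed
  define \<eta> where "\<eta> = norm ((f - q f) y)"
  have \<eta>: "\<eta> > 0" using y by (simp add: \<eta>_def)
  define \<kappa> where "\<kappa> = \<eta> / (2 * (M + 1))"
  have \<kappa>: "\<kappa> > 0" "M * \<kappa> \<le> \<eta> / 2"
    using \<eta> M by (auto simp: \<kappa>_def field_simps)
  obtain t where t: "t > 0" and tail: "\<And>x y i. x \<in> X \<Longrightarrow> y \<in> X \<Longrightarrow> N x \<le> 1 \<Longrightarrow> N y \<le> 1 \<Longrightarrow>
      \<forall>\<^sub>F j in F. N (T i x + scl (of_real t) (y - T j y)) \<le> 1 + \<kappa> * t"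
    using smooth_tails[OF \<kappa>(1)] by blast
  have "norm (q f x) \<le> M - t * \<eta> / 2" if x: "x \<in> X" "N x \<le> 1" for x
  proof -
    have "norm (f (T i x)) \<le> M - t * \<eta> / 2" for i
    proof -
      obtain c :: 'k where c: "norm c = 1" and phase: "norm (f (T i x) + c * (of_real t * (f - q f) y)) =
          norm (f (T i x)) + norm (of_real t * (f - q f) y)"
        using exists_phase by blast
      let ?y = "scl c y"
      have y': "?y \<in> X" "N ?y \<le> 1"
        using y c subspace_scale[OF X] by (auto simp: N_scale)
      have "\<forall>\<^sub>F j in F. norm (f (T i x) + of_real t * f (?y - T j ?y)) \<le> M * (1 + \<kappa> * t)"
        using tail[OF x(1) y'(1) x(2) y'(2), of i]
      proof eventually_elim
        case (elim j)
        have yj: "?y - T j ?y \<in> X" using y' T_X subspace_diff[OF X] by blast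
        have "norm (f (T i x + scl (of_real t) (?y - T j ?y))) \<le> M * (1 + \<kappa> * t)"
          unfolding M_def using elim t \<kappa>(1)
          by (intro D_norm f subspace_add[OF X] subspace_scale[OF X] T_X x yj) (auto intro: add_pos_nonneg)
        then show ?case
          by (simp add: D_add[OF f T_X[OF x(1)] subspace_scale[OF X yj]] D_scale[OF f yj])
      qed
      then have ev: "\<forall>\<^sub>F j in U. norm (f (T i x) + of_real t * f (?y - T j ?y)) \<le> M * (1 + \<kappa> * t)"
        using U(1) by (rule filter_leD[rotated])
      have "((\<lambda>j. norm (f (T i x) + of_real t * f (?y - T j ?y))) \<longlongrightarrow>
          norm (f (T i x) + of_real t * (f - q f) ?y)) U"
        by (intro tendsto_norm tendsto_add tendsto_const tendsto_mult_left complement_tendsto f y')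
      from tendsto_upperbound[OF this ev U(3)]
      have le: "norm (f (T i x) + of_real t * (f - q f) ?y) \<le> M * (1 + \<kappa> * t)" .
      have eq: "of_real t * (f - q f) ?y = c * (of_real t * (f - q f) y)"
        by (simp add: D_scale[OF f y(1)] D_scale[OF q_D[OF f] y(1)] algebra_simps)
      have "norm (f (T i x)) + t * \<eta> \<le> M * (1 + \<kappa> * t)"
        using le t unfolding eq phase \<eta>_def by (simp add: norm_mult)
      also have "\<dots> \<le> M + t * \<eta> / 2"
        using mult_left_mono[OF \<kappa>(2), of t] t by (simp add: algebra_simps)
      finally show ?thesis by simp
    qed
    then show ?thesis
      by (intro tendsto_upperbound[OF tendsto_norm[OF q_tendsto[OF f x(1)]] always_eventually U(3)]) simp
  qed
  then have "dual_norm X N (q f) \<le> M - t * \<eta> / 2" by (rule dual_norm_le)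
  also have "\<dots> < M" using t \<eta> by simp
  finally show ?thesis by (simp add: M_def)
qed

theorem J_hb_subspace: "hb_subspace scl X N J"
  unfolding hb_subspace_def
  using J q_D q_add q_scale q_idem kernel_q dual_norm_projection_strict dual_norm_complement
  by (intro conjI exI[of _ q] ballI allI impI) auto

end

section \<open>Vector-valued polynomials below the critical degree\<close>

theorem theorem3p4:
  fixes scaleE :: "'k::real_or_complex \<Rightarrow> 'e::banach \<Rightarrow> 'e"
    and scaleF :: "'k \<Rightarrow> 'f::banach \<Rightarrow> 'f"
    and L :: "'i \<Rightarrow> 'f \<Rightarrow> 'f" and \<F> :: "'i filter" and n :: nat
  assumes E: "banach_over scaleE"
    and n: "1 \<le> n" "enat n < critical_degree scaleE"
    and F: "banach_over scaleF" "infinite_dimensional scaleF"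
    and smooth: "asymptotically_uniformly_smooth scaleF"
    and approx: "shrinking_metric_compact_approx scaleF \<F> L"
    and compl: "\<forall>\<beta>. onorm (\<lambda>x. x - L \<beta> x) \<le> 1"
  shows "hb_subspace (fun_scale scaleF) (poly_space scaleE scaleF n) poly_norm
           (weak_poly_space scaleE scaleF n)"
proof -
  interpret P: banach_pair scaleE scaleF n
    using E F(1) n(1) by (simp add: banach_pair_def banach_pair_axioms_def)
  interpret S: smooth_approximation scaleF L \<F>
    using F smooth approx compl by (simp add: smooth_approximation_def smooth_approximation_axioms_def)
  let ?X = "poly_space scaleE scaleF n"
  let ?T = "\<lambda>i P x. L i (P x)"
  have weak: "?T i P \<in> weak_poly_space scaleE scaleF n" if "P \<in> ?X" for i P
    using n(2) P.F.asymptotically_uniformly_smooth_separates[OF smooth] S.compact_L that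
    by (rule P.compact_operator_comp_weak)
  have "approximated_subspace (fun_scale scaleF) ?X (weak_poly_space scaleE scaleF n) poly_norm ?T \<F>"
    unfolding approximated_subspace_def approximated_subspace_axioms_def
      module.subspace_def[OF P.module_scaleX]
  proof (intro conjI allI ballI impI)
    show "module (fun_scale scaleF :: 'k \<Rightarrow> ('e \<Rightarrow> 'f) \<Rightarrow> 'e \<Rightarrow> 'f)" by (rule P.module_scaleX)
    show "0 \<in> ?X" by (rule P.poly_zero)
    show "closed_subspace (fun_scale scaleF) ?X poly_norm (weak_poly_space scaleE scaleF n)"
      by (rule P.weak_closed_subspace)
    show "\<F> \<noteq> bot" by (rule S.F_nontrivial)
    fix P assume P: "P \<in> ?X"
    show "0 \<le> poly_norm P" using P by (rule P.poly_norm_nonneg)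
    show "?T i P \<in> weak_poly_space scaleE scaleF n" for i using P by (rule weak)
    show "poly_norm (?T i P) \<le> poly_norm P" for i
      by (intro P.poly_norm_le order_trans[OF S.norm_L] P.norm_le_poly_norm P)
    show "poly_norm (P - ?T i P) \<le> poly_norm P" for i
      by (intro P.poly_norm_le) (simp, intro order_trans[OF S.norm_compl] P.norm_le_poly_norm P)
    show "fun_scale scaleF c P \<in> ?X" for c using P by (rule P.poly_scale)
    show "poly_norm (fun_scale scaleF c P) = norm c * poly_norm P" for c
      using P by (rule P.poly_norm_scale)
    show "?T i (fun_scale scaleF c P) = fun_scale scaleF c (?T i P)" for i c
      by (simp add: fun_scale_def fun_eq_iff P.F.compact_operator_scale[OF S.compact_L])
    fix Q assume Q: "Q \<in> ?X"
    show "P + Q \<in> ?X" using P Q by (rule P.poly_add)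
    show "?T i (P + Q) = ?T i P + ?T i Q" for i
      by (simp add: fun_eq_iff P.F.compact_operator_add[OF S.compact_L])
  next
    fix P assume P: "P \<in> weak_poly_space scaleE scaleF n"
    show "((\<lambda>i. poly_norm (?T i P - P)) \<longlongrightarrow> 0) \<F>"
    proof (rule tendstoI)
      fix e :: real assume "e > 0"
      then have "\<forall>\<^sub>F i in \<F>. poly_norm (?T i P - P) \<le> e / 2"
        using P by (intro P.weak_approximation S.bounded_linear_L S.norm_L S.L_tendsto) auto
      then show "\<forall>\<^sub>F i in \<F>. dist (poly_norm (?T i P - P)) 0 < e"
      proof eventually_elim
        case (elim i)
        have "?T i P - P \<in> ?X"
          using weak P P.weak_subset by (intro P.poly_diff) auto
        then show ?case
          using elim \<open>e > 0\<close> P.poly_norm_nonneg by (simp add: dist_real_def)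
      qed
    qed
  next
    fix \<kappa> :: real assume \<kappa>: "\<kappa> > 0"
    obtain t where t: "t > 0" "smooth_modulus scaleF t < \<kappa> * t"
      using P.F.small_smooth_modulus[OF smooth \<kappa>] by blast
    have "\<forall>\<^sub>F j in \<F>. poly_norm (?T i P + fun_scale scaleF (of_real t) (Q - ?T j Q)) \<le> 1 + \<kappa> * t"
      if P: "P \<in> ?X" "poly_norm P \<le> 1" and Q: "Q \<in> ?X" "poly_norm Q \<le> 1" for P Q i
    proof -
      have K: "compact (closure (L i ` cball 0 1))" "closure (L i ` cball 0 1) \<subseteq> cball 0 1"
        using S.compact_L[of i] unfolding compact_operator_def
        by (blast, intro closure_minimal) (auto intro: order_trans[OF S.norm_L])
      from S.smooth_tail_compact[OF K t] show ?thesis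
      proof eventually_elim
        case (elim j)
        show ?case
        proof (rule P.poly_norm_le)
          fix x :: 'e assume x: "norm x \<le> 1"
          have "norm (P x) \<le> 1" "norm (Q x) \<le> 1"
            using P.norm_le_poly_norm[OF P(1) x] P.norm_le_poly_norm[OF Q(1) x] P(2) Q(2) by auto
          then have "L i (P x) \<in> closure (L i ` cball 0 1)" "Q x \<in> cball 0 1"
            by (auto intro!: subsetD[OF closure_subset])
          with elim show "norm ((?T i P + fun_scale scaleF (of_real t) (Q - ?T j Q)) x) \<le> 1 + \<kappa> * t"
            by (simp add: fun_scale_def P.F.scale_of_real)
        qed
      qed
    qed
    with t(1) show "\<exists>t>0. \<forall>P\<in>?X. \<forall>Q\<in>?X. \<forall>i. poly_norm P \<le> 1 \<longrightarrow> poly_norm Q \<le> 1 \<longrightarrow>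
        (\<forall>\<^sub>F j in \<F>. poly_norm (?T i P + fun_scale scaleF (of_real t) (Q - ?T j Q)) \<le> 1 + \<kappa> * t)"
      by blast
  qed
  then show ?thesis
    by (rule approximated_subspace.J_hb_subspace)
qed

end
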